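(* For the Doi--Onsager interaction $W_{\mathrm{DO}}(\theta)=-|\sin(2\pi\theta)|$ on $\mathbb T$, the free energy $\mathcal F_K$ undergoes a continuous phase transition at $$K_c=K_\#=\frac{3\pi}{4}.$$
   Context: $\mathbb T=[-\frac12,\frac12)$ with periodic boundary conditions; $\mathcal P(\mathbb T)$ denotes Borel probability measures, identified with densities when absolutely continuous; $q_u\equiv1$ is the uniform distribution. Fourier coefficients: $\widehat f(k)=\int_{\mathbb T}f(\theta)e^{-2\pi ik\theta}d\theta$. Free energy: for $K\ge0$, $\mathcal F_K(q)=\int_{\mathbb T}\log q\,dq-K\iint W(\theta-\theta')\,dq(\theta)dq(\theta')$ ($+\infty$ if $q$ is not absolutely continuous). A number $K_c\ge0$ is the critical coupling if for $K<K_c$, $q_u$ is the unique global minimizer of $\mathcal F_K$; at $K=K_c$, $q_u$ is a global minimizer; for $K>K_c$ there is a global minimizer $q\ne q_u$. The phase transition is continuous if at $K=K_c$ the global minimizer is unique and for every family $\{q_K:K>K_c\}$ of global minimizers, $\limsup_{K\to K_c^+}\|q_K-q_u\|_{L^1}=0$; otherwise discontinuous. The linear stability threshold is $K_\#=\big(2\max_{k\ge1,\widehat W(k)>0}\widehat W(k)\big)^{-1}$. Here $W_{\mathrm{DO}}(\theta)=-\frac2\pi+\frac4\pi\sum_{\ell\ge1}\frac{\cos(4\pi\ell\theta)}{4\ell^2-1}$. *)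

theory Defs
  imports "HOL-Analysis.Analysis"
begin

definition torus :: "real set" where
  "torus = {-1/2..<1/2}"

text \<open>Probability densities on T (Borel probability measures that are absolutely
  continuous w.r.t. Lebesgue measure; non-absolutely-continuous measures have
  free energy +infinity and are never minimizers).\<close>
definition is_density :: "(real \<Rightarrow> real) \<Rightarrow> bool" where
  "is_density q \<longleftrightarrow> q \<in> borel_measurable lborel \<and> (\<forall>\<theta>\<in>torus. 0 \<le> q \<theta>)
     \<and> set_integrable lborel torus q \<and> (LINT \<theta>:torus|lborel. q \<theta>) = 1"

definition q_unif :: "real \<Rightarrow> real" where
  "q_unif = (\<lambda>_. 1)"

text \<open>Entropy term \<open>\<integral> q log q\<close>; the integrand is bounded below, so
  non-integrability means the value +infinity.\<close>
definition entropy :: "(real \<Rightarrow> real) \<Rightarrow> ereal" where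
  "entropy q = (if set_integrable lborel torus (\<lambda>\<theta>. q \<theta> * ln (q \<theta>))
      then ereal (LINT \<theta>:torus|lborel. q \<theta> * ln (q \<theta>)) else \<infinity>)"

definition interaction :: "(real \<Rightarrow> real) \<Rightarrow> (real \<Rightarrow> real) \<Rightarrow> real" where
  "interaction W q = (LINT \<theta>:torus|lborel. LINT \<theta>':torus|lborel. W (\<theta> - \<theta>') * q \<theta> * q \<theta>')"

definition free_energy :: "(real \<Rightarrow> real) \<Rightarrow> real \<Rightarrow> (real \<Rightarrow> real) \<Rightarrow> ereal" where
  "free_energy W K q = entropy q - ereal (K * interaction W q)"

definition global_minimizer :: "(real \<Rightarrow> real) \<Rightarrow> real \<Rightarrow> (real \<Rightarrow> real) \<Rightarrow> bool" where
  "global_minimizer W K q \<longleftrightarrow> is_density q \<and>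
     (\<forall>p. is_density p \<longrightarrow> free_energy W K q \<le> free_energy W K p)"

definition is_uniform :: "(real \<Rightarrow> real) \<Rightarrow> bool" where
  "is_uniform q \<longleftrightarrow> (AE \<theta> in lborel. \<theta> \<in> torus \<longrightarrow> q \<theta> = q_unif \<theta>)"

definition l1_dist_unif :: "(real \<Rightarrow> real) \<Rightarrow> real" where
  "l1_dist_unif q = (LINT \<theta>:torus|lborel. \<bar>q \<theta> - q_unif \<theta>\<bar>)"

definition critical_coupling :: "(real \<Rightarrow> real) \<Rightarrow> real \<Rightarrow> bool" where
  "critical_coupling W Kc \<longleftrightarrow> 0 \<le> Kc
     \<and> (\<forall>K. 0 \<le> K \<and> K < Kc \<longrightarrow> global_minimizer W K q_unif
                \<and> (\<forall>q. global_minimizer W K q \<longrightarrow> is_uniform q))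
     \<and> global_minimizer W Kc q_unif
     \<and> (\<forall>K. K > Kc \<longrightarrow> (\<exists>q. global_minimizer W K q \<and> \<not> is_uniform q))"

text \<open>Continuous phase transition at Kc: unique minimizer at Kc and any family of
  minimizers for K > Kc converges to q_u in L1 as K tends to Kc from the right
  (for nonnegative quantities, limsup = 0 is the same as limit 0).\<close>
definition continuous_transition :: "(real \<Rightarrow> real) \<Rightarrow> real \<Rightarrow> bool" where
  "continuous_transition W Kc \<longleftrightarrow>
     (\<forall>q. global_minimizer W Kc q \<longrightarrow> is_uniform q)
     \<and> (\<forall>qs :: real \<Rightarrow> real \<Rightarrow> real. (\<forall>K. K > Kc \<longrightarrow> global_minimizer W K (qs K)) \<longrightarrow>
          ((\<lambda>K. l1_dist_unif (qs K)) \<longlongrightarrow> 0) (at_right Kc))"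

definition fourier_coeff :: "(real \<Rightarrow> real) \<Rightarrow> int \<Rightarrow> complex" where
  "fourier_coeff f k = (LINT \<theta>:torus|lborel. complex_of_real (f \<theta>) * cis (- 2 * pi * of_int k * \<theta>))"

text \<open>Linear stability threshold; the maximum over positive modes is taken as a supremum
  (it coincides with the maximum whenever the maximum exists).\<close>
definition K_sharp :: "(real \<Rightarrow> real) \<Rightarrow> real" where
  "K_sharp W = inverse (2 * Sup {Re (fourier_coeff W k) | k. k \<ge> 1 \<and>
        Im (fourier_coeff W k) = 0 \<and> Re (fourier_coeff W k) > 0})"

definition W_DO :: "real \<Rightarrow> real" where
  "W_DO \<theta> = - \<bar>sin (2 * pi * \<theta>)\<bar>"

end

theory Submission
  imports Defs "HOL-Complex_Analysis.Complex_Analysis"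
begin

text \<open>Only the even Fourier modes \<open>a k\<close> of a density interact, and after subtracting constants the free energy is
  \<open>entropy - s * (\<Sum>k. c k * |a k|\<^sup>2)\<close> with \<open>c k = 3 / (4 * k\<^sup>2 - 1)\<close> and \<open>s = K / K\<^sub>c\<close>. Testing the Gibbs
  variational principle with the potential generated by the density itself reduces \<open>K \<le> K\<^sub>c\<close> to an upper
  bound for \<open>ln (\<integral> exp f)\<close>, which is the Lebedev--Milin inequality \<open>ln (\<integral> exp f) \<le> (\<Sum>k. k * |f k|\<^sup>2)\<close> because
  \<open>k * c k \<le> 1\<close>, with equality only for \<open>k = 1\<close>. Keeping the loss in the second Taylor coefficient of the
  exponential yields a gap quadratic in the interaction energy, hence uniqueness at \<open>K\<^sub>c\<close> and
  convergence of minimizers as \<open>K\<close> decreases to \<open>K\<^sub>c\<close>. Since the interaction is a positive quadratic form,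
  linearizing it shows that for \<open>K > K\<^sub>c\<close> the problem has the same infimum as a dual functional on
  mode sequences, which is continuous on a compact product of discs.\<close>

section \<open>Taylor coefficients of the exponential of a polynomial\<close>

text \<open>Complex analysis enters because a potential is \<open>2 * Re g\<close> with
  \<open>g\<close> a power series in the first mode without constant term. Its exponential is the
  square of \<open>|exp g|\<close>, so Parseval turns the partition function \<open>Z\<close> into a
  sum of squared Taylor coefficients. With \<open>S\<close> the mode energy, the Gibbs principle
  bounds the entropy below by \<open>2 * S - ln Z\<close>, and Lebedev-Milin gives
  \<open>ln Z \<le> S\<close>: exactly the \<open>S\<close> needed at threshold is left.

  The delicate case is the threshold itself, where a small first mode costs nothing at quadratic
  order. Its square, however, enters the second Taylor coefficient, where the loss vanishes only if
  a suitable second mode is present; that mode pays in turn because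
  \<open>2 * coupling 2 = 2 / 5 < 1\<close>. The combined loss is of fourth order in the first mode,
  that is, quadratic in \<open>S\<close>.

  The energy does not see the odd modes, so control of \<open>S\<close> alone does not identify a
  minimizer. Minimality turns it into control of the entropy, and the entropy bounds the L1 distance
  to the uniform density.\<close>

definition exp_poly_coeff :: "complex poly \<Rightarrow> nat \<Rightarrow> complex" where
  "exp_poly_coeff p = fps_nth (fps_expansion (\<lambda>z. exp (poly p z)) 0)"

lemma exp_poly_holomorphic: "(\<lambda>z. exp (poly p z)) holomorphic_on A"
  by (intro holomorphic_intros)

lemma exp_poly_sums: "(\<lambda>n. exp_poly_coeff p n * z ^ n) sums exp (poly p z)"
proof -
  have "(\<lambda>n. (deriv ^^ n) (\<lambda>z. exp (poly p z)) 0 / fact n * (z - 0) ^ n) sums exp (poly p z)"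
    by (rule holomorphic_power_series[where r = "norm z + 1"]) (auto intro: exp_poly_holomorphic)
  then show ?thesis
    by (simp add: exp_poly_coeff_def fps_expansion_def)
qed

lemma exp_poly_summable: "summable (\<lambda>n. norm (exp_poly_coeff p n))"
  using powser_insidea[of "exp_poly_coeff p" 2 1] exp_poly_sums[of p 2]
  by (simp add: sums_iff)

lemma exp_poly_coeff_0: "coeff p 0 = 0 \<Longrightarrow> exp_poly_coeff p 0 = 1"
  by (simp add: exp_poly_coeff_def fps_expansion_def poly_0_coeff_0)

text \<open>Comparison of coefficients in the differential equation \<open>F' = p' * F\<close> for
  \<open>F = exp p\<close>.\<close>

lemma exp_poly_coeff_Suc:
  "of_nat (Suc n) * exp_poly_coeff p (Suc n)
     = (\<Sum>k\<le>n. of_nat (Suc k) * coeff p (Suc k) * exp_poly_coeff p (n - k))"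
proof -
  define F where "F = fps_expansion (\<lambda>z. exp (poly p z)) 0"
  have F: "(\<lambda>z. exp (poly p z)) has_fps_expansion F"
    unfolding F_def by (rule has_fps_expansion_fps_expansion[of UNIV]) (auto intro: exp_poly_holomorphic)
  have "deriv (\<lambda>z. exp (poly p z)) = (\<lambda>z. poly (pderiv p) z * exp (poly p z))"
    by (intro ext DERIV_imp_deriv) (auto intro!: derivative_eq_intros poly_DERIV)
  then have "(\<lambda>z. poly (pderiv p) z * exp (poly p z)) has_fps_expansion fps_deriv F"
    using has_fps_expansion_deriv[OF F] by simp
  moreover have "(\<lambda>z. poly (pderiv p) z * exp (poly p z)) has_fps_expansion (fps_of_poly (pderiv p) * F)"
    by (intro has_fps_expansion_mult F) (simp add: has_fps_expansion_def)
  ultimately have "fps_deriv F = fps_of_poly (pderiv p) * F"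
    by (rule fps_expansion_unique_complex)
  then have "fps_nth (fps_deriv F) n = (\<Sum>k\<le>n. coeff (pderiv p) k * fps_nth F (n - k))"
    by (simp add: fps_mult_nth atLeast0AtMost)
  then show ?thesis
    by (simp add: exp_poly_coeff_def F_def coeff_pderiv algebra_simps)
qed

text \<open>In the recurrence for \<open>n * a n\<close>, Cauchy-Schwarz over its \<open>n\<close>
  summands costs a factor \<open>n\<close>. This cancels one of the two factors \<open>n\<close> on
  the squared left side and leaves the recurrence of \<open>exp q\<close>.\<close>

lemma exp_poly_coeff_majorant:
  assumes p: "coeff p 0 = 0"
    and q: "\<And>k. coeff q k = of_real (real k * (norm (coeff p k))\<^sup>2)"
  shows "Im (exp_poly_coeff q n) = 0 \<and> (norm (exp_poly_coeff p n))\<^sup>2 \<le> Re (exp_poly_coeff q n)"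
proof (induction n rule: less_induct)
  case (less n)
  let ?a = "exp_poly_coeff p" and ?A = "exp_poly_coeff q"
  show ?case
  proof (cases n)
    case 0
    then show ?thesis using p q[of 0] by (simp add: exp_poly_coeff_0)
  next
    case (Suc m)
    have IH: "Im (?A (m - k)) = 0" "(norm (?a (m - k)))\<^sup>2 \<le> Re (?A (m - k))" for k
      using less.IH[of "m - k"] Suc by auto
    have A: "of_nat (Suc m) * ?A (Suc m) = (\<Sum>k\<le>m. of_real ((real (Suc k) * norm (coeff p (Suc k)))\<^sup>2) * ?A (m - k))"
      unfolding exp_poly_coeff_Suc q by (intro sum.cong refl) (simp add: power2_eq_square field_simps)
    have ReA: "real (Suc m) * Re (?A (Suc m)) = (\<Sum>k\<le>m. (real (Suc k) * norm (coeff p (Suc k)))\<^sup>2 * Re (?A (m - k)))"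
      using arg_cong[OF A, of Re] by (simp del: of_nat_Suc of_real_power of_real_mult)
    have ImA: "real (Suc m) * Im (?A (Suc m)) = 0"
      using arg_cong[OF A, of Im] IH(1) by (simp del: of_nat_Suc of_real_power of_real_mult)
    have "(real (Suc m) * norm (?a (Suc m)))\<^sup>2 = (norm (\<Sum>k\<le>m. of_nat (Suc k) * coeff p (Suc k) * ?a (m - k)))\<^sup>2"
      unfolding exp_poly_coeff_Suc[symmetric] by (simp add: norm_mult del: of_nat_Suc)
    also have "\<dots> \<le> (\<Sum>k\<le>m. real (Suc k) * norm (coeff p (Suc k)) * norm (?a (m - k)))\<^sup>2"
      by (intro power_mono norm_sum[THEN order_trans] sum_mono) (simp_all add: norm_mult del: of_nat_Suc)
    also have "\<dots> \<le> (\<Sum>k\<le>m. (real (Suc k) * norm (coeff p (Suc k)) * norm (?a (m - k)))\<^sup>2) * real (card {..m})"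
      by (rule sum_squared_le_sum_of_squares)
    also have "\<dots> \<le> (\<Sum>k\<le>m. (real (Suc k) * norm (coeff p (Suc k)))\<^sup>2 * Re (?A (m - k))) * real (card {..m})"
      using IH(2) by (intro mult_right_mono sum_mono) (auto simp: power_mult_distrib mult_left_mono)
    also have "\<dots> = real (Suc m)^2 * Re (?A (Suc m))"
      unfolding ReA[symmetric] by (simp add: power2_eq_square del: of_nat_Suc)
    finally have "(norm (?a (Suc m)))\<^sup>2 \<le> Re (?A (Suc m))"
      by (simp add: power_mult_distrib del: of_nat_Suc)
    then show ?thesis using ImA Suc by simp
  qed
qed

lemma exp_poly_coeff_1: "coeff p 0 = 0 \<Longrightarrow> exp_poly_coeff p 1 = coeff p 1"
  using exp_poly_coeff_Suc[of 0 p] by (simp add: exp_poly_coeff_0)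

lemma exp_poly_coeff_2: "coeff p 0 = 0 \<Longrightarrow> exp_poly_coeff p 2 = coeff p 2 + (coeff p 1)\<^sup>2 / 2"
  using exp_poly_coeff_Suc[of 1 p] exp_poly_coeff_1[of p]
  by (simp add: exp_poly_coeff_0 numeral_2_eq_2 field_simps power2_eq_square)

text \<open>The deficit on the left is what the majorant loses at index 2; it excludes that the first
  mode alone saturates the inequality.\<close>
lemma lebedev_milin_deficit:
  assumes p: "coeff p 0 = 0"
  shows "(\<Sum>n. (norm (exp_poly_coeff p n))\<^sup>2) + (norm (coeff p 2 - (coeff p 1)\<^sup>2 / 2))\<^sup>2
           \<le> exp (\<Sum>k\<le>degree p. real k * (norm (coeff p k))\<^sup>2)"
proof -
  let ?D = "(norm (coeff p 2 - (coeff p 1)\<^sup>2 / 2))\<^sup>2"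
  define q where "q = (\<Sum>k\<le>degree p. monom (of_real (real k * (norm (coeff p k))\<^sup>2)) k :: complex poly)"
  have q: "coeff q k = of_real (real k * (norm (coeff p k))\<^sup>2)" for k
    unfolding q_def coeff_sum coeff_monom
    by (cases "k \<le> degree p") (auto simp: coeff_eq_0)
  let ?a = "\<lambda>n. (norm (exp_poly_coeff p n))\<^sup>2" and ?A = "\<lambda>n. Re (exp_poly_coeff q n)"
  note maj = exp_poly_coeff_majorant[OF p q]
  \<comment> \<open>Evaluation at 1 sums all coefficients of the majorant.\<close>
  have "poly q 1 = of_real (\<Sum>k\<le>degree p. real k * (norm (coeff p k))\<^sup>2)"
    by (simp add: q_def poly_sum poly_monom)
  then have "exp_poly_coeff q sums of_real (exp (\<Sum>k\<le>degree p. real k * (norm (coeff p k))\<^sup>2))"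
    using exp_poly_sums[of q 1] by (simp add: exp_of_real del: of_real_sum of_real_mult)
  from sums_Re[OF this] have A: "?A sums exp (\<Sum>k\<le>degree p. real k * (norm (coeff p k))\<^sup>2)"
    by simp
  have le: "?a n + (if n = 2 then ?D else 0) \<le> ?A n" for n
  proof (cases "n = 2")
    case True
    have q0: "coeff q 0 = 0" by (simp add: q)
    have "Re ((of_real x)\<^sup>2) = x\<^sup>2" for x by (simp add: power2_eq_square)
    moreover have "?A 2 = 2 * (norm (coeff p 2))\<^sup>2 + (norm (coeff p 1))^4 / 2"
      unfolding exp_poly_coeff_2[OF q0] q 
      by (simp flip: of_real_power add: norm_power)
    \<comment> \<open>The parallelogram law makes the loss at index 2 exactly \<open>?D\<close>: the
      majorant's coefficient there is \<open>2 * |x|^2 + 2 * |y|^2\<close> for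
      \<open>x = coeff p 2\<close>, \<open>y = (coeff p 1)^2 / 2\<close>.\<close>
    moreover have "(norm (x + y))\<^sup>2 + (norm (x - y))\<^sup>2 = 2 * (norm x)\<^sup>2 + 2 * (norm y)\<^sup>2" for x y :: complex
      unfolding cmod_power2 by (simp add: algebra_simps power2_eq_square)
    from this[of "coeff p 2" "(coeff p 1)\<^sup>2 / 2"]
    have "(norm (coeff p 2 + (coeff p 1)\<^sup>2 / 2))\<^sup>2 + ?D = 2 * (norm (coeff p 2))\<^sup>2 + (norm (coeff p 1))^4 / 2"
      by (simp add: norm_power norm_divide power_divide)
    ultimately show ?thesis using True by (simp add: exp_poly_coeff_2[OF p])
  qed (use maj in simp)
  have sm: "summable ?a"
    by (rule summable_comparison_test'[OF sums_summable[OF A], of 0]) (use maj in auto)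
  have "(\<lambda>n. ?a n + (if n = 2 then ?D else 0)) sums (suminf ?a + ?D)"
    by (intro sums_add summable_sums sm sums_single)
  from sums_le[OF _ this A] le show "suminf ?a + ?D \<le> exp (\<Sum>k\<le>degree p. real k * (norm (coeff p k))\<^sup>2)"
    by blast
qed

section \<open>Fourier series on the torus\<close>

definition torus_measure :: "real measure" where
  "torus_measure = restrict_space lborel torus"

text \<open>The Fourier mode of frequency \<open>2 * k\<close>. With this indexing
  \<open>mode k\<close> is the \<open>k\<close>-th power of \<open>mode 1\<close>, so that series of
  modes are boundary values of power series.\<close>

definition mode :: "nat \<Rightarrow> real \<Rightarrow> complex" where
  "mode k \<theta> = cis (4 * pi * real k * \<theta>)"

lemma torus_borel: "torus \<in> sets borel"
  by (simp add: torus_def)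

lemma space_torus_measure [simp]: "space torus_measure = torus"
  by (simp add: torus_measure_def space_restrict_space)

lemma emeasure_torus_measure: "emeasure torus_measure torus = 1"
  by (simp add: torus_measure_def emeasure_restrict_space torus_borel) (simp add: torus_def)

lemma measure_torus_measure [simp]: "measure torus_measure torus = 1"
  by (simp add: measure_def emeasure_torus_measure)

interpretation torus: finite_measure torus_measure
  by standard (simp add: emeasure_torus_measure)

lemma set_integrable_torus:
  fixes f :: "real \<Rightarrow> 'a::{banach, second_countable_topology}"
  shows "set_integrable lborel torus f \<longleftrightarrow> integrable torus_measure f"
  by (simp add: set_integrable_def torus_measure_def integrable_restrict_space torus_borel)

lemma set_integral_torus:
  fixes f :: "real \<Rightarrow> 'a::{banach, second_countable_topology}"
  shows "(LINT \<theta>:torus|lborel. f \<theta>) = integral\<^sup>L torus_measure f"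
  by (simp add: set_lebesgue_integral_def torus_measure_def integral_restrict_space torus_borel)

lemma borel_measurable_torus [measurable (raw)]:
  "f \<in> borel_measurable borel \<Longrightarrow> f \<in> borel_measurable torus_measure"
  unfolding torus_measure_def by (rule measurable_restrict_space1) simp

lemma AE_torus: "(AE x in torus_measure. P x) \<longleftrightarrow> (AE x in lborel. x \<in> torus \<longrightarrow> P x)"
  unfolding torus_measure_def by (rule AE_restrict_space_iff) (simp add: torus_borel)

lemma integrable_torus_bounded:
  fixes f :: "real \<Rightarrow> 'a::{banach, second_countable_topology}"
  assumes "f \<in> borel_measurable torus_measure" "\<And>x. x \<in> torus \<Longrightarrow> norm (f x) \<le> B"
  shows "integrable torus_measure f"
  using assms by (intro torus.integrable_const_bound[of _ B]) (auto intro!: AE_I2)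

text \<open>Summability is carried by \<open>C\<close> and integrability by \<open>h\<close>; the
  weight \<open>h\<close> admits terms multiplied by an unbounded density.\<close>

lemma integral_dominated_suminf:
  fixes f :: "nat \<Rightarrow> 'a \<Rightarrow> 'b::{banach, second_countable_topology}"
  assumes meas: "\<And>n. f n \<in> borel_measurable M" and h: "integrable M h"
    and bound: "\<And>n x. x \<in> space M \<Longrightarrow> norm (f n x) \<le> C n * h x"
    and C: "summable C"
  shows "integrable M (\<lambda>x. \<Sum>n. f n x)"
    and "(\<lambda>n. integral\<^sup>L M (f n)) sums (\<integral>x. (\<Sum>n. f n x) \<partial>M)"
proof -
  have int: "integrable M (f n)" for n
    by (rule Bochner_Integration.integrable_bound[of M "\<lambda>x. C n * h x"])
       (use h in \<open>auto intro!: AE_I2 meas intro: order_trans[OF bound abs_ge_self]\<close>)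
  have sm: "AE x in M. summable (\<lambda>n. norm (f n x))"
  proof (rule AE_I2)
    fix x assume x: "x \<in> space M"
    have "summable (\<lambda>n. C n * h x)"
      using C by (rule summable_mult2)
    then show "summable (\<lambda>n. norm (f n x))"
      by (rule summable_comparison_test'[where N = 0]) (use bound[OF x] in auto)
  qed
  have "summable (\<lambda>n. \<integral>x. norm (f n x) \<partial>M)"
  proof (rule summable_comparison_test'[where N = 0])
    show "summable (\<lambda>n. C n * integral\<^sup>L M h)"
      using C by (rule summable_mult2)
    have "(\<integral>x. norm (f n x) \<partial>M) \<le> (\<integral>x. C n * h x \<partial>M)" for n
      by (rule integral_mono) (use int bound h in auto)
    then show "norm (\<integral>x. norm (f n x) \<partial>M) \<le> C n * integral\<^sup>L M h" for n
      by simp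
  qed
  from integrable_suminf[OF int sm this] sums_integral[OF int sm this]
  show "integrable M (\<lambda>x. \<Sum>n. f n x)"
    and "(\<lambda>n. integral\<^sup>L M (f n)) sums (\<integral>x. (\<Sum>n. f n x) \<partial>M)" .
qed

lemma integral_cis_torus:
  assumes "m \<noteq> 0"
  shows "(\<integral>\<theta>. cis (2 * pi * of_int m * \<theta>) \<partial>torus_measure) = 0"
proof -
  let ?f = "\<lambda>\<theta>. cis (2 * pi * of_int m * \<theta>)"
  define F where "F \<theta> = ?f \<theta> / (2 * pi * of_int m * \<i>)" for \<theta>
  have fm: "?f \<in> borel_measurable borel"
    by (intro borel_measurable_continuous_onI continuous_intros)
  have "(\<integral>\<theta>. ?f \<theta> \<partial>torus_measure) = (\<integral>\<theta>. indicator torus \<theta> *\<^sub>R ?f \<theta> \<partial>lborel)"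
    by (simp add: torus_measure_def integral_restrict_space torus_borel)
  also have "\<dots> = (\<integral>\<theta>. indicator {-1/2..1/2} \<theta> *\<^sub>R ?f \<theta> \<partial>lborel)"
  proof (rule integral_cong_AE)
    show "AE \<theta> in lborel. indicator torus \<theta> *\<^sub>R ?f \<theta> = indicator {-1/2..1/2} \<theta> *\<^sub>R ?f \<theta>"
      using AE_lborel_singleton[of "1/2"] by eventually_elim (auto simp: torus_def indicator_def)
  qed (auto intro!: borel_measurable_scaleR borel_measurable_indicator fm simp: torus_borel)
  also have "\<dots> = F (1/2) - F (-1/2)"
  proof (rule integral_FTC_Icc)
    fix x :: real
    show "(F has_vector_derivative ?f x) (at x within {-1/2..1/2})"
      unfolding F_def has_vector_derivative_def using assms
      by (auto intro!: derivative_eq_intros simp: fun_eq_iff scaleR_conv_of_real)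
        (simp add: complex_eq_iff)
  qed (auto intro!: continuous_intros)
  also have "\<dots> = 0"
    by (simp add: F_def cis.ctr complex_eq_iff)
  finally show ?thesis .
qed

lemma mode_simps [simp]: "norm (mode k \<theta>) = 1" "mode 0 \<theta> = 1"
  by (simp_all add: mode_def)

lemma mode_power: "mode 1 \<theta> ^ k = mode k \<theta>"
  unfolding mode_def Complex.DeMoivre by (rule arg_cong[of _ _ cis]) simp

lemma borel_measurable_mode [measurable]: "mode k \<in> borel_measurable borel"
  unfolding mode_def by (intro borel_measurable_continuous_onI continuous_intros)

lemma borel_measurable_cnj_mode [measurable]: "(\<lambda>\<theta>. cnj (mode k \<theta>)) \<in> borel_measurable borel"
  unfolding mode_def by (intro borel_measurable_continuous_onI continuous_intros)

lemma mode_mult_cnj: "mode k \<theta> * cnj (mode l \<theta>) = cis (2 * pi * of_int (2 * (int k - int l)) * \<theta>)"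
  by (simp add: mode_def cis_cnj cis_mult algebra_simps)

lemma integral_mode_orthonormal:
  "(\<integral>\<theta>. mode k \<theta> * cnj (mode l \<theta>) \<partial>torus_measure) = (if k = l then 1 else 0)"
proof (cases "k = l")
  case True
  then show ?thesis
    unfolding mode_mult_cnj by simp
next
  case False
  then show ?thesis
    unfolding mode_mult_cnj by (subst integral_cis_torus) auto
qed

section \<open>Parseval and the Lebedev-Milin inequality on the circle\<close>

lemma parseval_torus:
  fixes \<beta> :: "nat \<Rightarrow> complex"
  assumes \<beta>: "summable (\<lambda>n. norm (\<beta> n))"
  shows "(\<lambda>n. (norm (\<beta> n))\<^sup>2) sums (\<integral>\<theta>. (norm (\<Sum>n. \<beta> n * mode n \<theta>))\<^sup>2 \<partial>torus_measure)"
proof -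
  let ?h = "\<lambda>\<theta>. \<Sum>n. \<beta> n * mode n \<theta>"
  have sm: "summable (\<lambda>n. norm (\<beta> n * mode n \<theta>))" for \<theta>
    using \<beta> by (simp add: norm_mult)
  have hm [measurable]: "?h \<in> borel_measurable borel"
    by measurable
  have hb: "norm (?h \<theta>) \<le> (\<Sum>n. norm (\<beta> n))" for \<theta>
    using summable_norm[OF sm[of \<theta>]] by (simp add: norm_mult)
  have coef: "(\<integral>\<theta>. ?h \<theta> * cnj (mode m \<theta>) \<partial>torus_measure) = \<beta> m" for m
  proof -
    have "(\<lambda>n. \<integral>\<theta>. \<beta> n * mode n \<theta> * cnj (mode m \<theta>) \<partial>torus_measure)
            sums (\<integral>\<theta>. (\<Sum>n. \<beta> n * mode n \<theta> * cnj (mode m \<theta>)) \<partial>torus_measure)"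
      by (rule integral_dominated_suminf(2)[where h = "\<lambda>_. 1" and C = "\<lambda>n. norm (\<beta> n)"])
         (use \<beta> in \<open>auto simp: norm_mult\<close>)
    also have "(\<lambda>\<theta>. \<Sum>n. \<beta> n * mode n \<theta> * cnj (mode m \<theta>)) = (\<lambda>\<theta>. ?h \<theta> * cnj (mode m \<theta>))"
      using summable_norm_cancel[OF sm] by (simp add: suminf_mult2)
    also have "(\<lambda>n. \<integral>\<theta>. \<beta> n * mode n \<theta> * cnj (mode m \<theta>) \<partial>torus_measure)
        = (\<lambda>n. \<beta> n * (if n = m then 1 else 0))"
      by (simp only: mult.assoc integral_mult_right_zero integral_mode_orthonormal)
    also have "\<dots> = (\<lambda>n. if n = m then \<beta> n else 0)"
      by auto
    finally show ?thesis
      using sums_unique2[OF _ sums_single[of m \<beta>]] by simp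
  qed
  \<comment> \<open>Only the conjugate factor of \<open>|h|^2\<close> is expanded; each term is then
    a coefficient computed in \<open>coef\<close>.\<close>
  have "(\<lambda>n. \<integral>\<theta>. cnj (\<beta> n) * (?h \<theta> * cnj (mode n \<theta>)) \<partial>torus_measure)
            sums (\<integral>\<theta>. (\<Sum>n. cnj (\<beta> n) * (?h \<theta> * cnj (mode n \<theta>))) \<partial>torus_measure)"
    by (rule integral_dominated_suminf(2)[where h = "\<lambda>_. \<Sum>n. norm (\<beta> n)" and C = "\<lambda>n. norm (\<beta> n)"])
       (use \<beta> hb in \<open>auto simp: norm_mult intro!: mult_left_mono\<close>)
  also have "(\<lambda>\<theta>. \<Sum>n. cnj (\<beta> n) * (?h \<theta> * cnj (mode n \<theta>))) = (\<lambda>\<theta>. of_real ((norm (?h \<theta>))\<^sup>2))"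
  proof
    fix \<theta>
    have "(\<lambda>n. cnj (\<beta> n * mode n \<theta>)) sums cnj (?h \<theta>)"
      unfolding sums_cnj by (rule summable_sums[OF summable_norm_cancel[OF sm]])
    then have "(\<lambda>n. ?h \<theta> * cnj (\<beta> n * mode n \<theta>)) sums (?h \<theta> * cnj (?h \<theta>))"
      by (rule sums_mult)
    then show "(\<Sum>n. cnj (\<beta> n) * (?h \<theta> * cnj (mode n \<theta>))) = of_real ((norm (?h \<theta>))\<^sup>2)"
      unfolding complex_norm_square by (simp add: sums_iff mult_ac)
  qed
  also have "(\<lambda>n. \<integral>\<theta>. cnj (\<beta> n) * (?h \<theta> * cnj (mode n \<theta>)) \<partial>torus_measure) = (\<lambda>n. of_real ((norm (\<beta> n))\<^sup>2))"
    unfolding complex_norm_square integral_mult_right_zero coef by (simp add: mult.commute)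
  finally show ?thesis
    by (simp only: integral_complex_of_real sums_of_real_iff)
qed

text \<open>Since \<open>exp (2 * Re w) = |exp w|^2\<close>, this is Parseval for the boundary
  values of \<open>exp p\<close>.\<close>

lemma integral_exp_poly_mode:
  "(\<lambda>n. (norm (exp_poly_coeff p n))\<^sup>2) sums (\<integral>\<theta>. exp (2 * Re (poly p (mode 1 \<theta>))) \<partial>torus_measure)"
proof -
  have "(norm (\<Sum>n. exp_poly_coeff p n * mode n \<theta>))\<^sup>2 = exp (2 * Re (poly p (mode 1 \<theta>)))" for \<theta>
    using exp_poly_sums[of p "mode 1 \<theta>", unfolded mode_power, THEN sums_unique, symmetric]
    by (simp add: exp_double)
  then show ?thesis
    using parseval_torus[OF exp_poly_summable[of p]] by simp
qed

text \<open>Truncations are polynomials in \<open>mode 1\<close>. Absolute summability bounds their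
  exponents uniformly, so dominated convergence passes to the limit.\<close>

lemma lebedev_milin_torus:
  assumes b0: "b 0 = 0" and b: "summable (\<lambda>k. norm (b k))"
    and T: "summable (\<lambda>k. real k * (norm (b k))\<^sup>2)"
  shows "(\<integral>\<theta>. exp (2 * Re (\<Sum>k. b k * mode k \<theta>)) \<partial>torus_measure) + (norm (b 2 - (b 1)\<^sup>2 / 2))\<^sup>2
           \<le> exp (\<Sum>k. real k * (norm (b k))\<^sup>2)"
proof -
  let ?D = "(norm (b 2 - (b 1)\<^sup>2 / 2))\<^sup>2"
  let ?f = "\<lambda>N \<theta>. 2 * Re (\<Sum>k<N. b k * mode k \<theta>)"
  have bm: "summable (\<lambda>k. norm (b k * mode k \<theta>))" for \<theta>
    using b by (simp add: norm_mult)
  have fb: "?f N \<theta> \<le> 2 * (\<Sum>k. norm (b k))" for N \<theta>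
  proof -
    have "Re (\<Sum>k<N. b k * mode k \<theta>) \<le> (\<Sum>k<N. norm (b k))"
      by (rule order_trans[OF complex_Re_le_cmod sum_norm_le]) (simp add: norm_mult)
    also have "\<dots> \<le> (\<Sum>k. norm (b k))"
      by (rule sum_le_suminf) (use b in auto)
    finally show ?thesis by simp
  qed
  have "(\<lambda>N. (\<integral>\<theta>. exp (?f N \<theta>) \<partial>torus_measure) + ?D)
      \<longlonglongrightarrow> (\<integral>\<theta>. exp (2 * Re (\<Sum>k. b k * mode k \<theta>)) \<partial>torus_measure) + ?D"
  proof (intro tendsto_add tendsto_const integral_dominated_convergence)
    show "AE \<theta> in torus_measure. (\<lambda>N. exp (?f N \<theta>)) \<longlonglongrightarrow> exp (2 * Re (\<Sum>k. b k * mode k \<theta>))"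
      by (intro AE_I2 tendsto_exp tendsto_mult_left tendsto_Re summable_LIMSEQ summable_norm_cancel[OF bm])
    show "AE \<theta> in torus_measure. norm (exp (?f N \<theta>)) \<le> exp (2 * (\<Sum>k. norm (b k)))" for N
      using fb by simp
  qed simp_all
  \<comment> \<open>From \<open>N = 3\<close> on, the truncation retains the coefficients 1 and 2
    that enter \<open>?D\<close>.\<close>
  moreover have "(\<integral>\<theta>. exp (?f N \<theta>) \<partial>torus_measure) + ?D \<le> exp (\<Sum>k. real k * (norm (b k))\<^sup>2)" if N: "N \<ge> 3" for N
  proof -
    define p where "p = (\<Sum>k<N. monom (b k) k)"
    have cp: "coeff p k = (if k < N then b k else 0)" for k
      unfolding p_def coeff_sum coeff_monom by auto
    have p0: "coeff p 0 = 0" by (simp add: cp b0)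
    have "poly p (mode 1 \<theta>) = (\<Sum>k<N. b k * mode k \<theta>)" for \<theta>
      unfolding p_def poly_sum poly_monom mode_power ..
    then have "(\<integral>\<theta>. exp (?f N \<theta>) \<partial>torus_measure) = (\<Sum>n. (norm (exp_poly_coeff p n))\<^sup>2)"
      using integral_exp_poly_mode[of p] by (simp add: sums_iff)
    then have "(\<integral>\<theta>. exp (?f N \<theta>) \<partial>torus_measure) + ?D \<le> exp (\<Sum>k\<le>degree p. real k * (norm (coeff p k))\<^sup>2)"
      using lebedev_milin_deficit[OF p0] N by (simp add: cp)
    also have "\<dots> \<le> exp (\<Sum>k\<le>degree p. real k * (norm (b k))\<^sup>2)"
      by (simp add: cp sum_mono)
    also have "\<dots> \<le> exp (\<Sum>k. real k * (norm (b k))\<^sup>2)"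
      by (simp, rule sum_le_suminf[OF T]) auto
    finally show ?thesis .
  qed
  ultimately show ?thesis
    by (intro LIMSEQ_le_const2) auto
qed

text \<open>Keeps the Parseval terms 0 and 1. This lower bound produces the instability above the
  threshold.\<close>

lemma integral_exp_first_mode_ge:
  "1 + (norm b)\<^sup>2 \<le> (\<integral>\<theta>. exp (2 * Re (b * mode 1 \<theta>)) \<partial>torus_measure)"
proof -
  let ?p = "monom b 1" and ?a = "exp_poly_coeff (monom b 1)"
  have "(\<Sum>n<2. (norm (?a n))\<^sup>2) \<le> (\<integral>\<theta>. exp (2 * Re (poly ?p (mode 1 \<theta>))) \<partial>torus_measure)"
    using integral_exp_poly_mode[of ?p] by (metis sum_le_suminf sums_iff finite_lessThan zero_le_power2)
  moreover have "(\<Sum>n<2. (norm (?a n))\<^sup>2) = 1 + (norm b)\<^sup>2"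
    using exp_poly_coeff_1[of ?p] exp_poly_coeff_0[of ?p] by (simp add: numeral_2_eq_2)
  ultimately show ?thesis
    by (simp add: poly_monom)
qed

section \<open>The Gibbs variational principle\<close>

lemma is_density_torus:
  assumes "is_density q"
  shows "q \<in> borel_measurable borel" "\<And>\<theta>. \<theta> \<in> torus \<Longrightarrow> 0 \<le> q \<theta>"
    "integrable torus_measure q" "integral\<^sup>L torus_measure q = 1"
  using assms by (auto simp: is_density_def set_integrable_torus set_integral_torus)

lemma integrable_density_mult:
  fixes f :: "real \<Rightarrow> 'a::{banach, second_countable_topology, real_normed_algebra_1}"
  assumes q: "integrable torus_measure q" and f: "f \<in> borel_measurable borel"
    and B: "\<And>\<theta>. \<theta> \<in> torus \<Longrightarrow> norm (f \<theta>) \<le> B"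
  shows "integrable torus_measure (\<lambda>\<theta>. q \<theta> *\<^sub>R f \<theta>)"
proof (rule Bochner_Integration.integrable_bound[of _ "\<lambda>\<theta>. B * \<bar>q \<theta>\<bar>"])
  show "AE \<theta> in torus_measure. norm (q \<theta> *\<^sub>R f \<theta>) \<le> norm (B * \<bar>q \<theta>\<bar>)"
  proof (rule AE_I2)
    fix \<theta> assume "\<theta> \<in> space torus_measure"
    then have fB: "norm (f \<theta>) \<le> B" by (simp add: B)
    then have "0 \<le> B" using norm_ge_zero order_trans by blast
    with mult_left_mono[OF fB abs_ge_zero, of "q \<theta>"]
    show "norm (q \<theta> *\<^sub>R f \<theta>) \<le> norm (B * \<bar>q \<theta>\<bar>)"
      by (simp add: abs_mult mult.commute)
  qed
  show "(\<lambda>\<theta>. q \<theta> *\<^sub>R f \<theta>) \<in> borel_measurable torus_measure"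
    using borel_measurable_integrable[OF q] borel_measurable_torus[OF f] by simp
qed (use q in simp)

lemma integrable_exp_bounded:
  fixes f :: "real \<Rightarrow> real"
  assumes f: "f \<in> borel_measurable borel" and B: "\<And>\<theta>. \<theta> \<in> torus \<Longrightarrow> \<bar>f \<theta>\<bar> \<le> B"
  shows "integrable torus_measure (\<lambda>\<theta>. exp (f \<theta>))" and "0 < (\<integral>\<theta>. exp (f \<theta>) \<partial>torus_measure)"
proof -
  note [measurable] = f
  show int: "integrable torus_measure (\<lambda>\<theta>. exp (f \<theta>))"
  proof (rule integrable_torus_bounded)
    show "norm (exp (f x)) \<le> exp B" if "x \<in> torus" for x
      using B[OF that] by simp
  qed simp
  have "(\<integral>\<theta>. exp (- B) \<partial>torus_measure) \<le> (\<integral>\<theta>. exp (f \<theta>) \<partial>torus_measure)"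
  proof (rule integral_mono)
    show "exp (- B) \<le> exp (f x)" if "x \<in> space torus_measure" for x
      using B[of x] that by simp
  qed (use int in auto)
  then have "exp (- B) \<le> (\<integral>\<theta>. exp (f \<theta>) \<partial>torus_measure)"
    by simp
  then show "0 < (\<integral>\<theta>. exp (f \<theta>) \<partial>torus_measure)"
    by (rule order_less_le_trans[OF exp_gt_zero])
qed

text \<open>Nonnegativity of the relative entropy of \<open>q\<close> with respect to the Gibbs
  density \<open>exp f / Z\<close>.\<close>

lemma gibbs_variational:
  assumes q: "is_density q" and ent: "integrable torus_measure (\<lambda>\<theta>. q \<theta> * ln (q \<theta>))"
    and f: "f \<in> borel_measurable borel" and B: "\<And>\<theta>. \<theta> \<in> torus \<Longrightarrow> \<bar>f \<theta>\<bar> \<le> B"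
  shows "(\<integral>\<theta>. q \<theta> * f \<theta> \<partial>torus_measure) - ln (\<integral>\<theta>. exp (f \<theta>) \<partial>torus_measure)
           \<le> (\<integral>\<theta>. q \<theta> * ln (q \<theta>) \<partial>torus_measure)"
proof -
  define Z where "Z = (\<integral>\<theta>. exp (f \<theta>) \<partial>torus_measure)"
  note qd = is_density_torus[OF q]
  have Z: "0 < Z" and expint: "integrable torus_measure (\<lambda>\<theta>. exp (f \<theta>))"
    using integrable_exp_bounded[OF f B] by (auto simp: Z_def)
  have qf: "integrable torus_measure (\<lambda>\<theta>. q \<theta> * f \<theta>)"
    using integrable_density_mult[OF qd(3) f, of B] B by simp
  \<comment> \<open>The added terms \<open>q - exp f / Z\<close> integrate to 0 and make the
    inequality hold pointwise, by \<open>ln x \<le> x - 1\<close>.\<close>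
  have "(\<integral>\<theta>. q \<theta> * f \<theta> - q \<theta> * ln Z + q \<theta> - exp (f \<theta>) / Z \<partial>torus_measure)
      \<le> (\<integral>\<theta>. q \<theta> * ln (q \<theta>) \<partial>torus_measure)"
  proof (rule integral_mono)
    fix \<theta> assume "\<theta> \<in> space torus_measure"
    then have "0 \<le> q \<theta>" using qd(2) by simp
    show "q \<theta> * f \<theta> - q \<theta> * ln Z + q \<theta> - exp (f \<theta>) / Z \<le> q \<theta> * ln (q \<theta>)"
    proof (cases "q \<theta> = 0")
      case False
      with \<open>0 \<le> q \<theta>\<close> have pos: "0 < q \<theta>" by simp
      have "ln (exp (f \<theta>) / (Z * q \<theta>)) \<le> exp (f \<theta>) / (Z * q \<theta>) - 1"
        using pos Z by (intro ln_le_minus_one) simp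
      then have "q \<theta> * (f \<theta> - (ln Z + ln (q \<theta>))) \<le> q \<theta> * (exp (f \<theta>) / (Z * q \<theta>) - 1)"
        using pos Z by (intro mult_left_mono) (simp_all add: ln_div ln_mult)
      also have "\<dots> = exp (f \<theta>) / Z - q \<theta>"
        using pos Z by (simp add: field_simps)
      finally show ?thesis by (simp add: algebra_simps)
    qed (use Z in simp)
  qed (use qd qf expint ent in auto)
  also have "(\<integral>\<theta>. q \<theta> * f \<theta> - q \<theta> * ln Z + q \<theta> - exp (f \<theta>) / Z \<partial>torus_measure)
      = (\<integral>\<theta>. q \<theta> * f \<theta> \<partial>torus_measure) - ln Z"
    using qd qf expint Z by (simp add: Z_def[symmetric])
  finally show ?thesis by (simp add: Z_def)
qed

text \<open>The equality case of the variational principle.\<close>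

lemma gibbs_density:
  assumes f: "f \<in> borel_measurable borel" and B: "\<And>\<theta>. \<bar>f \<theta>\<bar> \<le> B"
  defines "Z \<equiv> \<integral>\<theta>. exp (f \<theta>) \<partial>torus_measure"
  defines "p \<equiv> \<lambda>\<theta>. exp (f \<theta>) / Z"
  shows "is_density p" and "integrable torus_measure (\<lambda>\<theta>. p \<theta> * ln (p \<theta>))"
    and "(\<integral>\<theta>. p \<theta> * ln (p \<theta>) \<partial>torus_measure) = (\<integral>\<theta>. p \<theta> * f \<theta> \<partial>torus_measure) - ln Z"
proof -
  note [measurable] = f
  have Z: "0 < Z" and expint: "integrable torus_measure (\<lambda>\<theta>. exp (f \<theta>))"
    using integrable_exp_bounded[OF f B] by (auto simp: Z_def)
  show p: "is_density p"
    using Z expint unfolding is_density_def set_integrable_torus set_integral_torus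
    by (auto simp: p_def Z_def[symmetric])
  note pd = is_density_torus[OF p]
  have pf: "integrable torus_measure (\<lambda>\<theta>. p \<theta> * f \<theta>)"
    using integrable_density_mult[OF pd(3) f, of B] B by simp
  have eq: "p \<theta> * ln (p \<theta>) = p \<theta> * f \<theta> - p \<theta> * ln Z" for \<theta>
  proof -
    have "ln (p \<theta>) = f \<theta> - ln Z"
      using Z by (simp add: p_def ln_div)
    then show ?thesis by (simp add: right_diff_distrib)
  qed
  show "integrable torus_measure (\<lambda>\<theta>. p \<theta> * ln (p \<theta>))"
    unfolding eq using pf pd by simp
  show "(\<integral>\<theta>. p \<theta> * ln (p \<theta>) \<partial>torus_measure) = (\<integral>\<theta>. p \<theta> * f \<theta> \<partial>torus_measure) - ln Z"
    unfolding eq using pf pd by simp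
qed

section \<open>From entropy to the L1 distance\<close>

lemma exp_le_quadratic:
  fixes x :: real
  assumes "\<bar>x\<bar> \<le> 1"
  shows "exp x \<le> 1 + x + x\<^sup>2"
proof (cases "x \<ge> 0")
  case True
  then show ?thesis using exp_bound[of x] assms by simp
next
  case False
  \<comment> \<open>For negative \<open>x\<close> the product on the right is
    \<open>1 - x^3\<close>, which is at least 1.\<close>
  have "exp (- x) * (1 + x + x\<^sup>2) \<ge> (1 - x) * (1 + x + x\<^sup>2)"
    using exp_ge_add_one_self[of "- x"] False assms by (intro mult_right_mono) auto
  moreover have "(1 - x) * (1 + x + x\<^sup>2) \<ge> 1"
    using False by (simp add: algebra_simps power2_eq_square mult_le_0_iff)
  ultimately have "exp x * 1 \<le> exp x * (exp (- x) * (1 + x + x\<^sup>2))"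
    by (intro mult_left_mono) auto
  also have "\<dots> = 1 + x + x\<^sup>2"
    by (simp add: mult.assoc[symmetric] flip: exp_add)
  finally show ?thesis by simp
qed

text \<open>Pinsker's inequality up to the constant, from the Gibbs principle tested with a multiple
  of the sign of \<open>q - 1\<close>.\<close>
lemma l1_dist_unif_le_entropy:
  assumes q: "is_density q" and ent: "integrable torus_measure (\<lambda>\<theta>. q \<theta> * ln (q \<theta>))"
  shows "(l1_dist_unif q)\<^sup>2 / 4 \<le> (\<integral>\<theta>. q \<theta> * ln (q \<theta>) \<partial>torus_measure)"
proof -
  note qd = is_density_torus[OF q]
  note [measurable] = qd(1)
  \<comment> \<open>With \<open>l\<close> the L1 distance, this \<open>t\<close> maximizes
    \<open>t * l - t^2\<close>, with value \<open>l^2 / 4\<close>. Since \<open>l \<le> 2\<close>,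
    it stays in the range of \<open>exp_le_quadratic\<close>.\<close>
  define t where "t = l1_dist_unif q / 2"
  let ?s = "\<lambda>\<theta>. sgn (q \<theta> - 1)"
  have l1: "l1_dist_unif q = (\<integral>\<theta>. \<bar>q \<theta> - 1\<bar> \<partial>torus_measure)"
    by (simp add: l1_dist_unif_def set_integral_torus q_unif_def)
  have int1: "integrable torus_measure (\<lambda>\<theta>. \<bar>q \<theta> - 1\<bar>)"
    using qd by simp
  have t0: "0 \<le> t"
    by (simp add: t_def l1)
  have "l1_dist_unif q \<le> (\<integral>\<theta>. q \<theta> + 1 \<partial>torus_measure)"
    unfolding l1
  proof (rule integral_mono)
    show "\<bar>q x - 1\<bar> \<le> q x + 1" if "x \<in> space torus_measure" for x
      using qd(2)[of x] that by simp
  qed (use qd int1 in auto)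
  then have t1: "t \<le> 1"
    using qd by (simp add: t_def)
  have smeas [measurable]: "?s \<in> borel_measurable borel"
    by measurable
  have sb: "norm (?s \<theta>) \<le> 1" for \<theta>
    by (simp add: sgn_real_def)
  have sint: "integrable torus_measure ?s"
    by (rule integrable_torus_bounded[where B = 1]) (use sb in auto)
  have qs: "integrable torus_measure (\<lambda>\<theta>. q \<theta> * ?s \<theta>)"
    using integrable_density_mult[OF qd(3) smeas sb] by simp
  have tb: "\<bar>t * ?s \<theta>\<bar> \<le> 1" for \<theta>
    using t0 t1 by (simp add: abs_mult sgn_real_def)
  let ?Z = "\<integral>\<theta>. exp (t * ?s \<theta>) \<partial>torus_measure"
  have Z0: "0 < ?Z" and Zint: "integrable torus_measure (\<lambda>\<theta>. exp (t * ?s \<theta>))"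
    using integrable_exp_bounded[of "\<lambda>\<theta>. t * ?s \<theta>" 1] tb by auto
  have "?Z \<le> (\<integral>\<theta>. 1 + t * ?s \<theta> + t\<^sup>2 \<partial>torus_measure)"
  proof (rule integral_mono)
    fix \<theta>
    have "(t * ?s \<theta>)\<^sup>2 \<le> t\<^sup>2"
      by (simp add: sgn_real_def power_mult_distrib)
    then show "exp (t * ?s \<theta>) \<le> 1 + t * ?s \<theta> + t\<^sup>2"
      using exp_le_quadratic[OF tb[of \<theta>]] by simp
  qed (use sint Zint in auto)
  also have "\<dots> = 1 + (t * integral\<^sup>L torus_measure ?s + t\<^sup>2)"
    using sint by simp
  finally have "ln ?Z \<le> t * integral\<^sup>L torus_measure ?s + t\<^sup>2"
    using Z0 ln_le_minus_one[OF Z0] by simp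
  moreover have "(\<integral>\<theta>. q \<theta> * (t * ?s \<theta>) \<partial>torus_measure) - ln ?Z \<le> (\<integral>\<theta>. q \<theta> * ln (q \<theta>) \<partial>torus_measure)"
    by (rule gibbs_variational[OF q ent, where B = 1]) (use tb in auto)
  moreover have "(\<integral>\<theta>. q \<theta> * (t * ?s \<theta>) \<partial>torus_measure) = t * (\<integral>\<theta>. q \<theta> * ?s \<theta> \<partial>torus_measure)"
    by (simp add: mult.left_commute)
  moreover have "(\<integral>\<theta>. q \<theta> * ?s \<theta> \<partial>torus_measure) - integral\<^sup>L torus_measure ?s = 2 * t"
  proof -
    have "(\<integral>\<theta>. q \<theta> * ?s \<theta> \<partial>torus_measure) - integral\<^sup>L torus_measure ?s
        = (\<integral>\<theta>. q \<theta> * ?s \<theta> - ?s \<theta> \<partial>torus_measure)"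
      using qs sint by simp
    also have "\<dots> = (\<integral>\<theta>. \<bar>q \<theta> - 1\<bar> \<partial>torus_measure)"
      by (intro Bochner_Integration.integral_cong refl) (auto simp: sgn_real_def)
    finally show ?thesis by (simp add: t_def l1)
  qed
  ultimately have "t * (2 * t) - t\<^sup>2 \<le> (\<integral>\<theta>. q \<theta> * ln (q \<theta>) \<partial>torus_measure)"
    by (smt (verit) right_diff_distrib)
  then show ?thesis
    by (simp add: t_def power2_eq_square)
qed

lemma l1_dist_unif_nonneg: "0 \<le> l1_dist_unif q"
  by (simp add: l1_dist_unif_def set_integral_torus)

lemma is_uniform_iff_l1:
  assumes "is_density q"
  shows "is_uniform q \<longleftrightarrow> l1_dist_unif q = 0"
proof -
  have "integrable torus_measure (\<lambda>\<theta>. \<bar>q \<theta> - 1\<bar>)"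
    using is_density_torus[OF assms] by simp
  from integral_nonneg_eq_0_iff_AE[OF this] show ?thesis
    by (simp add: l1_dist_unif_def set_integral_torus is_uniform_def q_unif_def AE_torus)
qed

section \<open>Mode energy and potential\<close>

text \<open>Normalized by \<open>coupling 1 = 1\<close>, which places the threshold at
  \<open>s = 1\<close>. The formula would give -3 at \<open>k = 0\<close>; the value 0 discards the
  constant mode.\<close>

definition coupling :: "nat \<Rightarrow> real" where
  "coupling k = (if k = 0 then 0 else 3 / (4 * (real k)\<^sup>2 - 1))"

definition mode_coeff :: "(real \<Rightarrow> real) \<Rightarrow> nat \<Rightarrow> complex" where
  "mode_coeff q k = (\<integral>\<theta>. of_real (q \<theta>) * cnj (mode k \<theta>) \<partial>torus_measure)"

definition mode_energy :: "(nat \<Rightarrow> complex) \<Rightarrow> real" where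
  "mode_energy a = (\<Sum>k. coupling k * (norm (a k))\<^sup>2)"

text \<open>The first variation of \<open>mode_energy\<close> at a density with mode coefficients
  \<open>a\<close>.\<close>

definition potential :: "(nat \<Rightarrow> complex) \<Rightarrow> real \<Rightarrow> real" where
  "potential a \<theta> = 2 * Re (\<Sum>k. of_real (coupling k) * a k * mode k \<theta>)"

text \<open>A compact set containing the mode coefficients of every density. Its elements need not
  come from a density, which is what relaxes the dual problem.\<close>

definition unit_seqs :: "(nat \<Rightarrow> complex) set" where
  "unit_seqs = {a. \<forall>k. norm (a k) \<le> 1}"

lemma coupling_values [simp]: "coupling 0 = 0" "coupling 1 = 1" "coupling (Suc 0) = 1" "coupling 2 = 1 / 5"
  by (simp_all add: coupling_def power2_eq_square)

lemma four_square_minus_one: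
  assumes "k \<noteq> 0"
  shows "3 * (real k)\<^sup>2 \<le> 4 * (real k)\<^sup>2 - 1" and "0 < 4 * (real k)\<^sup>2 - 1"
proof -
  have "1 \<le> (real k)\<^sup>2"
    by (rule one_le_power) (use assms in simp)
  then show "3 * (real k)\<^sup>2 \<le> 4 * (real k)\<^sup>2 - 1" and "0 < 4 * (real k)\<^sup>2 - 1"
    by linarith+
qed

lemma coupling_nonneg: "0 \<le> coupling k"
  using four_square_minus_one(2)[of k] by (auto simp: coupling_def)

lemma coupling_le_inverse_square: "coupling k \<le> 1 / (real k)\<^sup>2"
proof (cases "k = 0")
  case False
  have "3 / (4 * (real k)\<^sup>2 - 1) \<le> 3 / (3 * (real k)\<^sup>2)"
    using four_square_minus_one[OF False] False by (intro divide_left_mono) auto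
  with False show ?thesis
    by (simp add: coupling_def)
qed simp

lemma summable_coupling: "summable coupling"
proof (rule summable_comparison_test'[where N = 0])
  show "summable (\<lambda>k. 1 / (real k)\<^sup>2)"
    using inverse_power_summable[of 2, where 'a = real] by (simp add: inverse_eq_divide)
qed (use coupling_nonneg coupling_le_inverse_square in auto)

lemma mult_coupling_le: "real k * coupling k \<le> 1"
proof (cases "k = 0")
  case False
  then have "real k \<le> (real k)\<^sup>2" by (simp add: power2_eq_square)
  then have "real k * coupling k \<le> real k * (1 / (real k)\<^sup>2)"
    using coupling_le_inverse_square by (intro mult_left_mono) auto
  also have "\<dots> \<le> 1" using False by (simp add: power2_eq_square)
  finally show ?thesis .
qed simp

lemma mult_coupling_le_two_fifths:
  assumes "k \<ge> 2"
  shows "real k * coupling k \<le> 2 / 5"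
proof -
  \<comment> \<open>The product equals \<open>2 * (4 * k^2 - 1) - 15 * k\<close>; its root 2 is
    where the bound \<open>2 / 5\<close> is attained.\<close>
  have "0 \<le> (real k - 2) * (8 * real k + 1)"
    using assms by (intro mult_nonneg_nonneg) auto
  then have "15 * real k \<le> 2 * (4 * (real k)\<^sup>2 - 1)"
    by (simp add: algebra_simps power2_eq_square)
  moreover have "0 < 4 * (real k)\<^sup>2 - 1"
    using assms by (intro four_square_minus_one) simp
  ultimately show ?thesis
    using assms by (simp add: coupling_def field_simps)
qed

context
  fixes a :: "nat \<Rightarrow> complex"
  assumes a: "a \<in> unit_seqs"
begin

lemma norm_unit_seq: "norm (a k) \<le> 1" "(norm (a k))\<^sup>2 \<le> 1"
  using a by (auto simp: unit_seqs_def power_le_one)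

lemma norm_coupling_mode_le: "norm (of_real (coupling k) * a k * z) \<le> coupling k * norm z"
  using norm_unit_seq(1)[of k] coupling_nonneg[of k]
  by (simp add: norm_mult mult_right_mono mult_left_le)

lemma summable_coupling_seq: "summable (\<lambda>k. norm (of_real (coupling k) * a k))"
  by (rule summable_comparison_test'[OF summable_coupling, of 0])
     (use norm_coupling_mode_le[of _ 1] in simp)

lemma summable_coupling_mode: "summable (\<lambda>k. norm (of_real (coupling k) * a k * mode k \<theta>))"
  using summable_coupling_seq by (simp add: norm_mult)

lemma summable_mode_energy: "summable (\<lambda>k. coupling k * (norm (a k))\<^sup>2)"
  by (rule summable_comparison_test'[OF summable_coupling, of 0])
     (use norm_unit_seq coupling_nonneg in \<open>auto simp: mult_left_le\<close>)

lemma mode_energy_nonneg: "0 \<le> mode_energy a"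
  unfolding mode_energy_def by (intro suminf_nonneg summable_mode_energy) (simp add: coupling_nonneg)

lemma mode_energy_le: "mode_energy a \<le> suminf coupling"
  unfolding mode_energy_def
  by (intro suminf_le summable_mode_energy summable_coupling) (use norm_unit_seq coupling_nonneg in \<open>auto simp: mult_left_le\<close>)

lemma potential_bound: "\<bar>potential a \<theta>\<bar> \<le> 2 * suminf coupling"
proof -
  have "\<bar>Re (\<Sum>k. of_real (coupling k) * a k * mode k \<theta>)\<bar> \<le> norm (\<Sum>k. of_real (coupling k) * a k * mode k \<theta>)"
    by (rule abs_Re_le_cmod)
  also have "\<dots> \<le> (\<Sum>k. norm (of_real (coupling k) * a k * mode k \<theta>))"
    by (rule summable_norm[OF summable_coupling_mode])
  also have "\<dots> \<le> suminf coupling"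
    by (intro suminf_le summable_coupling_mode summable_coupling)
       (use norm_coupling_mode_le[of _ "mode _ \<theta>"] in simp)
  finally show ?thesis by (simp add: potential_def)
qed

lemma borel_measurable_potential: "potential a \<in> borel_measurable borel"
  unfolding potential_def by measurable

text \<open>Up to the factor 2, the pairing is the bilinear form that polarizes
  \<open>mode_energy\<close>. As \<open>p\<close> may be unbounded, \<open>|p|\<close> is the
  dominating weight.\<close>

lemma integral_mult_potential:
  assumes p: "integrable torus_measure p"
  shows "(\<lambda>k. 2 * coupling k * Re (a k * cnj (mode_coeff p k))) sums (\<integral>\<theta>. p \<theta> * potential a \<theta> \<partial>torus_measure)"
proof -
  have [measurable]: "p \<in> borel_measurable torus_measure"
    using p by auto
  have "(\<lambda>k. \<integral>\<theta>. p \<theta> * (2 * Re (of_real (coupling k) * a k * mode k \<theta>)) \<partial>torus_measure)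
     sums (\<integral>\<theta>. (\<Sum>k. p \<theta> * (2 * Re (of_real (coupling k) * a k * mode k \<theta>))) \<partial>torus_measure)"
  proof (rule integral_dominated_suminf(2)[where h = "\<lambda>\<theta>. \<bar>p \<theta>\<bar>" and C = "\<lambda>k. 2 * coupling k"])
    fix k \<theta>
    have "\<bar>Re (of_real (coupling k) * a k * mode k \<theta>)\<bar> \<le> coupling k"
      using abs_Re_le_cmod norm_coupling_mode_le[of k "mode k \<theta>"] by (metis mode_simps(1) mult.right_neutral order_trans)
    then show "norm (p \<theta> * (2 * Re (of_real (coupling k) * a k * mode k \<theta>))) \<le> 2 * coupling k * \<bar>p \<theta>\<bar>"
      by (simp add: abs_mult mult_left_mono mult.commute del: Re_complex_of_real)
  qed (use p summable_coupling in \<open>auto intro: summable_mult\<close>)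
  also have "(\<lambda>\<theta>. \<Sum>k. p \<theta> * (2 * Re (of_real (coupling k) * a k * mode k \<theta>))) = (\<lambda>\<theta>. p \<theta> * potential a \<theta>)"
  proof
    fix \<theta>
    have "(\<lambda>k. of_real (coupling k) * a k * mode k \<theta>) sums (\<Sum>k. of_real (coupling k) * a k * mode k \<theta>)"
      by (rule summable_sums[OF summable_norm_cancel[OF summable_coupling_mode]])
    from sums_mult[OF sums_mult[OF sums_Re[OF this], of 2], of "p \<theta>"]
    show "(\<Sum>k. p \<theta> * (2 * Re (of_real (coupling k) * a k * mode k \<theta>))) = p \<theta> * potential a \<theta>"
      unfolding potential_def by (rule sums_unique[symmetric])
  qed
  also have "(\<lambda>k. \<integral>\<theta>. p \<theta> * (2 * Re (of_real (coupling k) * a k * mode k \<theta>)) \<partial>torus_measure)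
      = (\<lambda>k. 2 * coupling k * Re (a k * cnj (mode_coeff p k)))"
  proof
    fix k
    have int: "integrable torus_measure (\<lambda>\<theta>. of_real (p \<theta>) * mode k \<theta>)"
      using integrable_density_mult[OF p borel_measurable_mode[of k], of 1] by (simp add: scaleR_conv_of_real)
    have "cnj (mode_coeff p k) = (\<integral>\<theta>. of_real (p \<theta>) * mode k \<theta> \<partial>torus_measure)"
      unfolding mode_coeff_def by (subst Bochner_Integration.integral_cnj[symmetric]) simp
    then have "2 * coupling k * Re (a k * cnj (mode_coeff p k))
      = Re (\<integral>\<theta>. of_real (2 * coupling k) * a k * (of_real (p \<theta>) * mode k \<theta>) \<partial>torus_measure)"
      by (simp add: mult.assoc)
    also have "\<dots> = (\<integral>\<theta>. Re (of_real (2 * coupling k) * a k * (of_real (p \<theta>) * mode k \<theta>)) \<partial>torus_measure)"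
      using int by (intro integral_Re[symmetric] integrable_mult_right)
    also have "\<dots> = (\<integral>\<theta>. p \<theta> * (2 * Re (of_real (coupling k) * a k * mode k \<theta>)) \<partial>torus_measure)"
      by (intro Bochner_Integration.integral_cong refl) (simp add: algebra_simps)
    finally show "(\<integral>\<theta>. p \<theta> * (2 * Re (of_real (coupling k) * a k * mode k \<theta>)) \<partial>torus_measure)
      = 2 * coupling k * Re (a k * cnj (mode_coeff p k))" ..
  qed
  finally show ?thesis .
qed

end

lemma mode_coeff_unit_seqs:
  assumes "is_density q"
  shows "mode_coeff q \<in> unit_seqs"
proof -
  note qd = is_density_torus[OF assms]
  have "norm (mode_coeff q k) \<le> 1" for k
  proof -
    have "norm (mode_coeff q k) \<le> (\<integral>\<theta>. norm (of_real (q \<theta>) * cnj (mode k \<theta>)) \<partial>torus_measure)"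
      unfolding mode_coeff_def by (rule integral_norm_bound)
    also have "\<dots> = integral\<^sup>L torus_measure q"
      by (intro Bochner_Integration.integral_cong refl) (use qd(2) in \<open>simp add: norm_mult\<close>)
    finally show ?thesis using qd by simp
  qed
  then show ?thesis by (simp add: unit_seqs_def)
qed

text \<open>Euler's identity for the quadratic form \<open>mode_energy\<close>.\<close>

lemma integral_mult_own_potential:
  assumes "is_density q"
  shows "(\<integral>\<theta>. q \<theta> * potential (mode_coeff q) \<theta> \<partial>torus_measure) = 2 * mode_energy (mode_coeff q)"
proof -
  let ?a = "mode_coeff q"
  have "Re (z * cnj z) = (norm z)\<^sup>2" for z
    by (simp flip: complex_norm_square of_real_power)
  then have "(\<lambda>k. 2 * (coupling k * (norm (?a k))\<^sup>2)) sums (\<integral>\<theta>. q \<theta> * potential ?a \<theta> \<partial>torus_measure)"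
    using integral_mult_potential[OF mode_coeff_unit_seqs[OF assms] is_density_torus(3)[OF assms]]
    by (simp add: mult.assoc)
  moreover have "(\<lambda>k. 2 * (coupling k * (norm (?a k))\<^sup>2)) sums (2 * mode_energy ?a)"
    unfolding mode_energy_def
    by (intro sums_mult summable_sums summable_mode_energy mode_coeff_unit_seqs assms)
  ultimately show ?thesis by (rule sums_unique2)
qed

section \<open>The entropy gap\<close>

text \<open>Lebedev-Milin for \<open>b k = coupling k * a k\<close>: \<open>T\<close> is the energy
  with its terms rescaled by \<open>k * coupling k\<close>, which is 1 at \<open>k = 1\<close> and
  at most \<open>2 / 5\<close> beyond. The remaining \<open>3 / 5\<close> is a linear loss charged
  to the modes above the first.\<close>

lemma lebedev_milin_potential:
  assumes a: "a \<in> unit_seqs"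
  defines "T \<equiv> \<Sum>k. real k * (norm (of_real (coupling k) * a k))\<^sup>2"
  shows "(\<integral>\<theta>. exp (potential a \<theta>) \<partial>torus_measure) + (norm (a 2 / 5 - (a 1)\<^sup>2 / 2))\<^sup>2 \<le> exp T"
    and "T + 3 / 5 * (mode_energy a - (norm (a 1))\<^sup>2) \<le> mode_energy a"
proof -
  let ?b = "\<lambda>k. of_real (coupling k) * a k"
  let ?e = "\<lambda>k. coupling k * (norm (a k))\<^sup>2"
  have b_eq: "real k * (norm (?b k))\<^sup>2 = (real k * coupling k) * ?e k" for k
    by (simp add: norm_mult power_mult_distrib power2_eq_square)
  have e_nonneg: "0 \<le> ?e k" for k
    by (simp add: coupling_nonneg)
  have Tsm: "summable (\<lambda>k. real k * (norm (?b k))\<^sup>2)"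
  proof (rule summable_comparison_test'[OF summable_mode_energy[OF a], of 0])
    show "norm (real k * (norm (?b k))\<^sup>2) \<le> ?e k" for k
      unfolding b_eq using mult_right_mono[OF mult_coupling_le e_nonneg, of k k] coupling_nonneg[of k] e_nonneg[of k]
      by (simp del: mult_eq_0_iff add: abs_mult)
  qed
  show "(\<integral>\<theta>. exp (potential a \<theta>) \<partial>torus_measure) + (norm (a 2 / 5 - (a 1)\<^sup>2 / 2))\<^sup>2 \<le> exp T"
    using lebedev_milin_torus[OF _ summable_coupling_seq[OF a] Tsm] by (simp add: potential_def T_def)
  let ?d = "\<lambda>k. if k = 1 then (norm (a k))\<^sup>2 else 0"
  have lhs: "(\<lambda>k. real k * (norm (?b k))\<^sup>2 + 3 / 5 * (?e k - ?d k))
      sums (T + 3 / 5 * (mode_energy a - (norm (a 1))\<^sup>2))"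
    unfolding T_def mode_energy_def
    by (intro sums_add sums_mult sums_diff summable_sums Tsm summable_mode_energy a sums_single)
  have rhs: "?e sums mode_energy a"
    unfolding mode_energy_def by (intro summable_sums summable_mode_energy a)
  have "real k * (norm (?b k))\<^sup>2 + 3 / 5 * (?e k - ?d k) \<le> ?e k" for k
  proof -
    consider "k = 0" | "k = 1" | "k \<ge> 2" by linarith
    then show ?thesis
    proof cases
      case 3
      then have "(real k * coupling k) * ?e k \<le> 2 / 5 * ?e k"
        by (intro mult_right_mono mult_coupling_le_two_fifths e_nonneg)
      then show ?thesis using 3 unfolding b_eq by simp
    qed (simp_all add: b_eq)
  qed
  then show "T + 3 / 5 * (mode_energy a - (norm (a 1))\<^sup>2) \<le> mode_energy a"
    by (rule sums_le[OF _ lhs rhs])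
qed

text \<open>Both losses are small only if the energy is: small \<open>R\<close> forces a small
  \<open>a 2\<close>, and then small \<open>D\<close> forces a small \<open>a 1\<close>. The square
  appears because \<open>D\<close> controls \<open>|a 1|^4\<close>.\<close>

lemma mode_energy_square_le:
  assumes a: "a \<in> unit_seqs"
  defines "D \<equiv> (norm (a 2 / 5 - (a 1)\<^sup>2 / 2))\<^sup>2" and "R \<equiv> mode_energy a - (norm (a 1))\<^sup>2"
  shows "0 \<le> R" and "(mode_energy a)\<^sup>2 \<le> 16 * D + (4 + 2 * suminf coupling) * R"
proof -
  let ?e = "\<lambda>k. coupling k * (norm (a k))\<^sup>2"
  have "sum ?e {1, 2} \<le> mode_energy a"
    unfolding mode_energy_def
    by (rule sum_le_suminf[OF summable_mode_energy[OF a]]) (auto simp: coupling_nonneg)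
  then have R2: "(norm (a 2))\<^sup>2 / 5 \<le> R"
    by (simp add: R_def)
  then show R0: "0 \<le> R"
    by (rule order_trans[rotated]) simp
  have RC: "R \<le> suminf coupling"
    using mode_energy_le[OF a] zero_le_power2[of "norm (a 1)"] unfolding R_def by linarith
  have "(norm (x - y))\<^sup>2 \<le> 2 * (norm x)\<^sup>2 + 2 * (norm y)\<^sup>2" for x y :: complex
  proof -
    have "(norm (x - y))\<^sup>2 + (norm (x + y))\<^sup>2 = 2 * (norm x)\<^sup>2 + 2 * (norm y)\<^sup>2"
      unfolding cmod_power2 by (simp add: algebra_simps power2_eq_square)
    then show ?thesis by (smt (verit) zero_le_power2)
  qed
  \<comment> \<open>These two vectors differ by \<open>(a 1)^2 / 2\<close>. The resulting term in
    \<open>a 2\<close> is below \<open>2 * R\<close> because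
    \<open>8 / 25 * 5 \<le> 2\<close>.\<close>
  from this[of "a 2 / 5" "a 2 / 5 - (a 1)\<^sup>2 / 2"]
  have "(norm (a 1))^4 \<le> 8 * D + 8 / 25 * (norm (a 2))\<^sup>2"
    by (simp add: D_def norm_divide norm_power power_divide)
  then have a1: "(norm (a 1))^4 \<le> 8 * D + 2 * R"
    using R2 R0 by simp
  have "(mode_energy a)\<^sup>2 = ((norm (a 1))\<^sup>2 + R)\<^sup>2"
    by (simp add: R_def)
  also have "\<dots> \<le> 2 * (norm (a 1))^4 + 2 * R\<^sup>2"
    using zero_le_power2[of "(norm (a 1))\<^sup>2 - R"] by (simp add: power2_eq_square algebra_simps numeral_eq_Suc)
  also have "R\<^sup>2 \<le> suminf coupling * R"
    unfolding power2_eq_square by (rule mult_right_mono[OF RC R0])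
  finally show "(mode_energy a)\<^sup>2 \<le> 16 * D + (4 + 2 * suminf coupling) * R"
    using a1 by (simp add: algebra_simps)
qed

text \<open>The Gibbs principle with the density's own potential leaves both losses,
  \<open>3 / 5 * R\<close> and a multiple of \<open>D\<close>, below entropy minus energy;
  \<open>mode_energy_square_le\<close> converts them into the squared energy.\<close>

lemma entropy_gap:
  obtains c where "c > 0"
    and "\<And>q. is_density q \<Longrightarrow> integrable torus_measure (\<lambda>\<theta>. q \<theta> * ln (q \<theta>)) \<Longrightarrow>
       mode_energy (mode_coeff q) + c * (mode_energy (mode_coeff q))\<^sup>2 \<le> (\<integral>\<theta>. q \<theta> * ln (q \<theta>) \<partial>torus_measure)"
proof
  define C where "C = suminf coupling"
  \<comment> \<open>Collects the constants when \<open>D \<le> exp C * (E - S)\<close> and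
    \<open>R \<le> 5 / 3 * (E - S)\<close> are inserted into the bound for the squared
    energy.\<close>
  define M where "M = 16 * exp C + (4 + 2 * C) * (5 / 3)"
  have C0: "0 \<le> C"
    unfolding C_def by (intro suminf_nonneg summable_coupling coupling_nonneg)
  then have M0: "0 < M"
    unfolding M_def by (intro add_pos_nonneg) auto
  then show "0 < 1 / M" by simp
  fix q assume q: "is_density q" and ent: "integrable torus_measure (\<lambda>\<theta>. q \<theta> * ln (q \<theta>))"
  define E where "E = (\<integral>\<theta>. q \<theta> * ln (q \<theta>) \<partial>torus_measure)"
  define a where "a = mode_coeff q"
  define S where "S = mode_energy a"
  define T where "T = (\<Sum>k. real k * (norm (of_real (coupling k) * a k))\<^sup>2)"
  define Z where "Z = (\<integral>\<theta>. exp (potential a \<theta>) \<partial>torus_measure)"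
  define D where "D = (norm (a 2 / 5 - (a 1)\<^sup>2 / 2))\<^sup>2"
  define R where "R = S - (norm (a 1))\<^sup>2"
  have a: "a \<in> unit_seqs" unfolding a_def by (rule mode_coeff_unit_seqs[OF q])
  have ZD: "Z + D \<le> exp T" and TR: "T + 3 / 5 * R \<le> S"
    using lebedev_milin_potential[OF a] by (simp_all add: Z_def D_def T_def R_def S_def)
  have R0: "0 \<le> R" and S2: "S\<^sup>2 \<le> 16 * D + (4 + 2 * C) * R"
    using mode_energy_square_le[OF a] by (simp_all add: D_def R_def S_def C_def)
  have TC: "T \<le> C"
    using TR R0 mode_energy_le[OF a] by (simp add: S_def C_def)
  have D0: "0 \<le> D" by (simp add: D_def)
  have Z0: "0 < Z"
    unfolding Z_def by (rule integrable_exp_bounded[OF borel_measurable_potential[OF a] potential_bound[OF a]])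
  \<comment> \<open>A linear bound for \<open>ln (exp T - D)\<close>; replacing \<open>T\<close> by
    its upper bound \<open>C\<close> makes the constant independent of \<open>q\<close>.\<close>
  have "ln (Z * exp (- T)) \<le> Z * exp (- T) - 1"
    using Z0 by (intro ln_le_minus_one) simp
  also have "\<dots> \<le> (exp T - D) * exp (- T) - 1"
    using ZD by (intro diff_right_mono mult_right_mono) auto
  also have "\<dots> = - (D * exp (- T))"
    by (simp add: left_diff_distrib flip: exp_add)
  also have "\<dots> \<le> - (D * exp (- C))"
    using TC D0 by (simp add: mult_left_mono)
  finally have lnZ: "ln Z \<le> T - D * exp (- C)"
    using Z0 by (simp add: ln_mult)
  have "(\<integral>\<theta>. q \<theta> * potential a \<theta> \<partial>torus_measure) - ln Z \<le> E"
    unfolding Z_def E_def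
    by (rule gibbs_variational[OF q ent borel_measurable_potential[OF a] potential_bound[OF a]])
  then have "2 * S - ln Z \<le> E"
    using integral_mult_own_potential[OF q] by (simp add: a_def S_def)
  then have gap: "3 / 5 * R + D * exp (- C) \<le> E - S"
    using lnZ TR by simp
  have "0 \<le> 3 / 5 * R" "0 \<le> D * exp (- C)"
    using R0 D0 by simp_all
  with gap have D': "D * exp (- C) \<le> E - S" and "3 / 5 * R \<le> E - S"
    by simp_all
  then have R: "R \<le> 5 / 3 * (E - S)" by simp
  have "D = exp C * (D * exp (- C))"
    by (simp add: mult.left_commute flip: exp_add)
  also have "\<dots> \<le> exp C * (E - S)"
    by (intro mult_left_mono D') simp
  finally have D: "D \<le> exp C * (E - S)" .
  have "S\<^sup>2 \<le> 16 * (exp C * (E - S)) + (4 + 2 * C) * (5 / 3 * (E - S))"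
    using C0 by (intro order_trans[OF S2] add_mono mult_left_mono D R) auto
  also have "\<dots> = M * (E - S)"
    by (simp add: M_def field_simps)
  finally have "1 / M * S\<^sup>2 \<le> E - S"
    using M0 by (simp add: field_simps)
  then show "mode_energy (mode_coeff q) + 1 / M * (mode_energy (mode_coeff q))\<^sup>2
      \<le> (\<integral>\<theta>. q \<theta> * ln (q \<theta>) \<partial>torus_measure)"
    by (simp add: E_def S_def a_def)
qed

section \<open>The dual functional\<close>

text \<open>The functional on mode sequences dual to \<open>entropy - s * mode_energy\<close>: both have the same infimum, but
  this one lives on a compact space.\<close>
definition dual_energy :: "real \<Rightarrow> (nat \<Rightarrow> complex) \<Rightarrow> real" where
  "dual_energy s a = s * mode_energy a - ln (\<integral>\<theta>. exp (s * potential a \<theta>) \<partial>torus_measure)"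

lemma potential_scaled:
  assumes "a \<in> unit_seqs"
  shows "(\<lambda>\<theta>. s * potential a \<theta>) \<in> borel_measurable borel"
    and "\<bar>s * potential a \<theta>\<bar> \<le> \<bar>s\<bar> * (2 * suminf coupling)"
  using borel_measurable_potential[OF assms] potential_bound[OF assms]
  by (simp_all add: abs_mult mult_left_mono del: mult.assoc)

text \<open>In the Gibbs principle with \<open>s\<close> times the own potential, the pairing is
  \<open>2 * s\<close> times the energy; half of it moves to the entropy side.\<close>

lemma dual_energy_le:
  assumes q: "is_density q" and ent: "integrable torus_measure (\<lambda>\<theta>. q \<theta> * ln (q \<theta>))"
  shows "dual_energy s (mode_coeff q)
    \<le> (\<integral>\<theta>. q \<theta> * ln (q \<theta>) \<partial>torus_measure) - s * mode_energy (mode_coeff q)"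
proof -
  let ?f = "potential (mode_coeff q)"
  have "(\<integral>\<theta>. q \<theta> * (s * ?f \<theta>) \<partial>torus_measure) = s * (\<integral>\<theta>. q \<theta> * ?f \<theta> \<partial>torus_measure)"
    by (simp add: mult.left_commute)
  with gibbs_variational[OF q ent potential_scaled[OF mode_coeff_unit_seqs[OF q]], of s]
  show ?thesis
    by (simp add: integral_mult_own_potential[OF q] dual_energy_def)
qed

text \<open>The witness is the Gibbs density of \<open>s * potential a\<close>. Nonnegative
  couplings bound its pairing with \<open>potential a\<close> by the sum of the two
  energies.\<close>

lemma dual_energy_attained_by_density:
  assumes a: "a \<in> unit_seqs" and s: "0 \<le> s"
  obtains p where "is_density p" "integrable torus_measure (\<lambda>\<theta>. p \<theta> * ln (p \<theta>))"
    "(\<integral>\<theta>. p \<theta> * ln (p \<theta>) \<partial>torus_measure) - s * mode_energy (mode_coeff p) \<le> dual_energy s a"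
proof -
  define Z where "Z = (\<integral>\<theta>. exp (s * potential a \<theta>) \<partial>torus_measure)"
  define p where "p \<theta> = exp (s * potential a \<theta>) / Z" for \<theta>
  note gd = gibbs_density[OF potential_scaled[OF a], of s, folded Z_def, folded p_def]
  have p: "mode_coeff p \<in> unit_seqs" by (rule mode_coeff_unit_seqs[OF gd(1)])
  have "(\<integral>\<theta>. p \<theta> * potential a \<theta> \<partial>torus_measure) \<le> mode_energy a + mode_energy (mode_coeff p)"
  proof (rule sums_le[OF _ integral_mult_potential[OF a is_density_torus(3)[OF gd(1)]]])
    show "(\<lambda>k. coupling k * (norm (a k))\<^sup>2 + coupling k * (norm (mode_coeff p k))\<^sup>2)
        sums (mode_energy a + mode_energy (mode_coeff p))"
      unfolding mode_energy_def by (intro sums_add summable_sums summable_mode_energy a p)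
    fix k
    have "2 * Re (x * cnj y) \<le> (norm x)\<^sup>2 + (norm y)\<^sup>2" for x y
      using zero_le_power2[of "norm (x - y)"] unfolding cmod_power2
      by (simp add: algebra_simps power2_eq_square)
    from mult_left_mono[OF this[of "a k" "mode_coeff p k"] coupling_nonneg[of k]]
    show "2 * coupling k * Re (a k * cnj (mode_coeff p k))
        \<le> coupling k * (norm (a k))\<^sup>2 + coupling k * (norm (mode_coeff p k))\<^sup>2"
      by (simp add: algebra_simps)
  qed
  from mult_left_mono[OF this s]
  have "(\<integral>\<theta>. p \<theta> * ln (p \<theta>) \<partial>torus_measure) - s * mode_energy (mode_coeff p) \<le> dual_energy s a"
    unfolding gd(3) dual_energy_def by (simp add: Z_def algebra_simps)
  with gd(1,2) show ?thesis by (rule that)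
qed

text \<open>Tychonoff's theorem, since the function type carries the product topology.\<close>

lemma compact_unit_seqs: "compact unit_seqs"
proof -
  have "compactin (product_topology (\<lambda>_. euclidean) UNIV) (PiE UNIV (\<lambda>_::nat. cball (0::complex) 1))"
    unfolding compactin_PiE by simp
  moreover have "PiE UNIV (\<lambda>_::nat. cball (0::complex) 1) = unit_seqs"
    by (auto simp: unit_seqs_def PiE_UNIV_domain)
  ultimately show ?thesis
    by (simp add: euclidean_product_topology)
qed

text \<open>Convergence in the product is only coordinatewise. The summable majorant
  \<open>coupling\<close> lets Tannery's theorem exchange limit and sum, and uniformly bounded
  potentials allow dominated convergence in the integral.\<close>

lemma continuous_on_dual_energy: "continuous_on unit_seqs (dual_energy s)"
proof (rule continuous_on_sequentiallyI)
  fix x :: "nat \<Rightarrow> nat \<Rightarrow> complex" and a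
  assume x: "\<forall>n. x n \<in> unit_seqs" and a: "a \<in> unit_seqs" and lim: "x \<longlonglongrightarrow> a"
  have coord: "(\<lambda>n. x n k) \<longlonglongrightarrow> a k" for k
    using continuous_on_tendsto_compose[OF continuous_on_product_coordinates[of k] lim] by simp
  have "(\<lambda>n. mode_energy (x n)) \<longlonglongrightarrow> mode_energy a"
    unfolding mode_energy_def
  proof (rule tannerys_theorem[THEN conjunct2, THEN conjunct2, OF _ _ summable_coupling])
    show "(\<lambda>n. coupling k * (norm (x n k))\<^sup>2) \<longlonglongrightarrow> coupling k * (norm (a k))\<^sup>2" for k
      by (intro tendsto_intros coord)
    show "\<forall>\<^sub>F (k, n) in at_top \<times>\<^sub>F sequentially. norm (coupling k * (norm (x n k))\<^sup>2) \<le> coupling k"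
      using norm_unit_seq(2)[OF x[rule_format]] coupling_nonneg
      by (intro always_eventually) (auto simp: mult_left_le)
  qed simp
  moreover have pot: "(\<lambda>n. potential (x n) \<theta>) \<longlonglongrightarrow> potential a \<theta>" for \<theta>
  proof -
    have "(\<lambda>n. \<Sum>k. of_real (coupling k) * x n k * mode k \<theta>) \<longlonglongrightarrow> (\<Sum>k. of_real (coupling k) * a k * mode k \<theta>)"
    proof (rule tannerys_theorem[THEN conjunct2, THEN conjunct2, OF _ _ summable_coupling])
      show "(\<lambda>n. of_real (coupling k) * x n k * mode k \<theta>) \<longlonglongrightarrow> of_real (coupling k) * a k * mode k \<theta>" for k
        by (intro tendsto_intros coord)
      show "\<forall>\<^sub>F (k, n) in at_top \<times>\<^sub>F sequentially. norm (of_real (coupling k) * x n k * mode k \<theta>) \<le> coupling k"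
        using norm_coupling_mode_le[OF x[rule_format], where z = "mode _ \<theta>"]
        by (intro always_eventually) auto
    qed simp
    then show ?thesis
      unfolding potential_def by (intro tendsto_mult tendsto_const tendsto_Re)
  qed
  moreover have "(\<lambda>n. \<integral>\<theta>. exp (s * potential (x n) \<theta>) \<partial>torus_measure)
      \<longlonglongrightarrow> (\<integral>\<theta>. exp (s * potential a \<theta>) \<partial>torus_measure)"
  proof (rule integral_dominated_convergence[where w = "\<lambda>_. exp (\<bar>s\<bar> * (2 * suminf coupling))"])
    show "AE \<theta> in torus_measure. (\<lambda>n. exp (s * potential (x n) \<theta>)) \<longlonglongrightarrow> exp (s * potential a \<theta>)"
      by (intro AE_I2 tendsto_exp tendsto_mult tendsto_const pot)
    show "AE \<theta> in torus_measure. norm (exp (s * potential (x n) \<theta>)) \<le> exp (\<bar>s\<bar> * (2 * suminf coupling))" for n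
      using abs_le_D1[OF potential_scaled(2)[OF x[rule_format], of s n]] by simp
  qed (use potential_scaled(1)[OF a, of s] potential_scaled(1)[OF x[rule_format], of s] in auto)
  moreover have "(\<integral>\<theta>. exp (s * potential a \<theta>) \<partial>torus_measure) \<noteq> 0"
    using integrable_exp_bounded(2)[OF potential_scaled[OF a], of s] by simp
  ultimately show "(\<lambda>n. dual_energy s (x n)) \<longlonglongrightarrow> dual_energy s a"
    unfolding dual_energy_def by (intro tendsto_diff tendsto_mult tendsto_const tendsto_ln) auto
qed

lemma dual_energy_minimizer:
  obtains a where "a \<in> unit_seqs" "\<And>b. b \<in> unit_seqs \<Longrightarrow> dual_energy s a \<le> dual_energy s b"
proof -
  have "(\<lambda>_. 0) \<in> unit_seqs" by (simp add: unit_seqs_def)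
  then show ?thesis
    using continuous_attains_inf[OF compact_unit_seqs _ continuous_on_dual_energy[of s]] that by blast
qed

text \<open>Only the first mode is excited. With \<open>x = s^2 * y\<close>, the energy term is
  \<open>x / s\<close> and the logarithm is at least \<open>ln (1 + x) \<ge> x / (1 + x)\<close>; so
  \<open>1 + x < s\<close> suffices.\<close>

lemma dual_energy_negative:
  assumes s: "1 < s"
  obtains a where "a \<in> unit_seqs" "dual_energy s a < 0"
proof
  \<comment> \<open>Chosen so that \<open>1 + s^2 * y\<close> is the midpoint of 1 and
    \<open>s\<close>.\<close>
  define y where "y = (s - 1) / (2 * s\<^sup>2)"
  define a :: "nat \<Rightarrow> complex" where "a k = (if k = 1 then of_real (sqrt y) else 0)" for k
  have y0: "0 < y" using s by (simp add: y_def)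
  have "s \<le> s\<^sup>2" using s by (simp add: power2_eq_square)
  then have "s - 1 \<le> 2 * s\<^sup>2" using s by linarith
  then have "y \<le> 1" using s by (simp add: y_def)
  then show "a \<in> unit_seqs"
    using y0 by (simp add: unit_seqs_def a_def)
  have "(\<lambda>k. coupling k * (norm (a k))\<^sup>2) = (\<lambda>k. if k = 1 then y else 0)"
    using y0 by (auto simp: a_def)
  then have energy: "mode_energy a = y"
    unfolding mode_energy_def using sums_unique[OF sums_single[of 1 "\<lambda>_. y"]] by simp
  have "(\<lambda>k. of_real (coupling k) * a k * mode k \<theta>) = (\<lambda>k. if k = 1 then of_real (sqrt y) * mode 1 \<theta> else 0)" for \<theta>
    by (auto simp: a_def)
  then have "potential a \<theta> = 2 * Re (of_real (sqrt y) * mode 1 \<theta>)" for \<theta>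
    unfolding potential_def using sums_unique[OF sums_single[of 1 "\<lambda>_. of_real (sqrt y) * mode 1 \<theta>"]] by simp
  then have pot: "s * potential a \<theta> = 2 * Re (of_real (s * sqrt y) * mode 1 \<theta>)" for \<theta>
    by simp
  have Z: "1 + s\<^sup>2 * y \<le> (\<integral>\<theta>. exp (s * potential a \<theta>) \<partial>torus_measure)" (is "_ \<le> ?Z")
    unfolding pot using integral_exp_first_mode_ge[of "of_real (s * sqrt y)"] y0 by (simp add: norm_mult power_mult_distrib)
  have sy: "s\<^sup>2 * y = (s - 1) / 2"
    using s by (simp add: y_def)
  have pos: "0 < 1 + s\<^sup>2 * y" using y0 by (intro add_pos_nonneg) auto
  have "1 + s\<^sup>2 * y < s"
    unfolding sy using s by (simp add: field_simps)
  then have "s * (1 + s\<^sup>2 * y) < s * s"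
    using s by (intro mult_strict_left_mono) auto
  from mult_strict_left_mono[OF this y0] have "s * y * (1 + s\<^sup>2 * y) < s\<^sup>2 * y"
    by (simp only: power2_eq_square mult_ac)
  then have "s * y < 1 - inverse (1 + s\<^sup>2 * y)"
    using pos by (simp add: field_simps)
  also have "\<dots> \<le> - ln (inverse (1 + s\<^sup>2 * y))"
    using ln_le_minus_one[of "inverse (1 + s\<^sup>2 * y)"] pos by simp
  also have "\<dots> = ln (1 + s\<^sup>2 * y)"
    using pos by (simp add: ln_inverse)
  also have "\<dots> \<le> ln ?Z"
    using pos Z by (intro ln_mono) auto
  finally show "dual_energy s a < 0"
    by (simp add: dual_energy_def energy)
qed

section \<open>The Doi--Onsager interaction\<close>

lemma coupling_Suc: "coupling (Suc n) = 3 / 2 * (1 / (2 * real n + 1) - 1 / (2 * real n + 3))"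
  by (simp add: coupling_def field_simps power2_eq_square)

text \<open>The partial fractions telescope. This is the value of the cosine series at multiples of
  \<open>pi\<close>.\<close>

lemma coupling_sums: "coupling sums (3 / 2)"
proof -
  have "(\<lambda>n. 1 / (2 * real n + 1)) \<longlonglongrightarrow> 0"
    by real_asymp
  from sums_mult[OF telescope_sums'[OF this], of "3 / 2"]
  have "(\<lambda>n. coupling (Suc n)) sums (3 / 2)"
    by (simp add: coupling_Suc algebra_simps)
  then show ?thesis
    by (simp add: sums_Suc_iff)
qed

text \<open>Inside the disc the series is an elementary expression in the area hyperbolic tangent; the boundary values are
  then obtained by Abel summation.\<close>
lemma coupling_power_series:
  fixes z :: complex
  assumes z: "norm z < 1"
  shows "(\<lambda>k. z * (of_real (coupling k) * z ^ (2 * k)))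
    sums (3 / 2 * ((z\<^sup>2 - 1) * (Ln ((1 + z) / (1 - z)) / 2) + z))"
proof -
  define A where "A = Ln ((1 + z) / (1 - z)) / 2"
  have "(\<lambda>n. (-1) ^ n / of_nat (2 * n + 1) * (\<i> * z) ^ (2 * n + 1)) sums Arctan (\<i> * z)"
    using Arctan_series(2)[of "\<i> * z"] z by (simp add: norm_mult)
  from sums_mult[OF this, of "- \<i>"]
  have "(\<lambda>n. - \<i> * ((-1) ^ n / of_nat (2 * n + 1) * (\<i> * z) ^ (2 * n + 1))) sums (- \<i> * Arctan (\<i> * z))" .
  also have "(\<lambda>n. - \<i> * ((-1) ^ n / of_nat (2 * n + 1) * (\<i> * z) ^ (2 * n + 1))) = (\<lambda>n. z ^ (2 * n + 1) / of_nat (2 * n + 1))"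
  proof
    fix n
    have pow: "(\<i> * z) ^ (2 * n + 1) = \<i> * (-1) ^ n * z ^ (2 * n + 1)"
      by (simp add: power_mult_distrib power_mult[of "\<i>"])
    show "- \<i> * ((-1) ^ n / of_nat (2 * n + 1) * (\<i> * z) ^ (2 * n + 1)) = z ^ (2 * n + 1) / of_nat (2 * n + 1)"
      unfolding pow by (cases "even n") simp_all
  qed
  also have "- \<i> * Arctan (\<i> * z) = A"
    by (simp add: Arctan_def A_def)
  finally have A: "(\<lambda>n. z ^ (2 * n + 1) / of_nat (2 * n + 1)) sums A" .
  then have "(\<lambda>n. z ^ (2 * Suc n + 1) / of_nat (2 * Suc n + 1)) sums (A - z)"
    by (subst sums_Suc_iff) simp
  \<comment> \<open>The factor \<open>z^2\<close> aligns the powers of neighbouring terms, whose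
    coefficients then differ as in \<open>coupling_Suc\<close>.\<close>
  from sums_mult[OF sums_diff[OF sums_mult[OF A, of "z\<^sup>2"] this], of "3 / 2"]
  have "(\<lambda>n. 3 / 2 * (z\<^sup>2 * (z ^ (2 * n + 1) / of_nat (2 * n + 1)) - z ^ (2 * Suc n + 1) / of_nat (2 * Suc n + 1)))
     sums (3 / 2 * (z\<^sup>2 * A - (A - z)))" .
  also have "(\<lambda>n. 3 / 2 * (z\<^sup>2 * (z ^ (2 * n + 1) / of_nat (2 * n + 1)) - z ^ (2 * Suc n + 1) / of_nat (2 * Suc n + 1)))
     = (\<lambda>n. z * (of_real (coupling (Suc n)) * z ^ (2 * Suc n)))"
  proof
    fix n
    have "of_real (coupling (Suc n)) = (3 / 2 * (1 / of_nat (2 * n + 1) - 1 / of_nat (2 * Suc n + 1)) :: complex)"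
      unfolding coupling_Suc by (simp add: algebra_simps)
    then show "3 / 2 * (z\<^sup>2 * (z ^ (2 * n + 1) / of_nat (2 * n + 1)) - z ^ (2 * Suc n + 1) / of_nat (2 * Suc n + 1))
      = z * (of_real (coupling (Suc n)) * z ^ (2 * Suc n))"
      by (simp add: right_diff_distrib left_diff_distrib power2_eq_square mult_ac)
  qed
  finally have "(\<lambda>n. z * (of_real (coupling (Suc n)) * z ^ (2 * Suc n))) sums (3 / 2 * (z\<^sup>2 * A - (A - z)))" .
  then have "(\<lambda>k. z * (of_real (coupling k) * z ^ (2 * k))) sums (3 / 2 * (z\<^sup>2 * A - (A - z)))"
    by (subst (asm) sums_Suc_iff) simp
  also have "z\<^sup>2 * A - (A - z) = (z\<^sup>2 - 1) * A + z"
    by (simp add: algebra_simps)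
  finally show ?thesis
    unfolding A_def .
qed

text \<open>Radial limit at \<open>u = cis x\<close>. There \<open>(1 + u) / (1 - u)\<close> lies on
  the positive imaginary axis, so \<open>Ln\<close> is continuous with imaginary part
  \<open>pi / 2\<close>, the only part of it that survives in the real part of the sum.\<close>

lemma coupling_cos_sums_interior:
  assumes x: "0 < x" "x < pi"
  shows "(\<lambda>k. coupling k * cos (2 * real k * x)) sums (3 / 2 - 3 * pi / 4 * sin x)"
proof -
  define u where "u = cis x"
  define r where "r n = real n / real (Suc n)" for n
  define H where "H = (\<Sum>k. of_real (coupling k) * u ^ (2 * k))"
  define B where "B z = Ln ((1 + z) / (1 - z)) / 2" for z :: complex
  have r: "0 \<le> r n" "r n < 1" for n by (simp_all add: r_def)
  have "r \<longlonglongrightarrow> 1" unfolding r_def by (rule LIMSEQ_n_over_Suc_n)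
  then have z: "(\<lambda>n. of_real (r n) * u) \<longlonglongrightarrow> u"
    using tendsto_mult[OF tendsto_of_real[of r 1 sequentially] tendsto_const[of u]] by simp
  have nu: "norm u = 1" by (simp add: u_def)
  have nz: "norm (of_real (r n) * u) = r n" for n
    using r[of n] by (simp add: norm_mult nu)
  have term_bound: "norm (of_real (coupling k) * (of_real (r n) * u) ^ (2 * k)) \<le> coupling k" for k n
    using r[of n] coupling_nonneg[of k]
    by (simp add: norm_mult norm_power nu nz power_le_one mult_left_le)
  have "(\<lambda>n. \<Sum>k. of_real (coupling k) * (of_real (r n) * u) ^ (2 * k)) \<longlonglongrightarrow> H"
    unfolding H_def
  proof (rule tannerys_theorem[THEN conjunct2, THEN conjunct2, OF _ _ summable_coupling])
    show "(\<lambda>n. of_real (coupling k) * (of_real (r n) * u) ^ (2 * k)) \<longlonglongrightarrow> of_real (coupling k) * u ^ (2 * k)" for k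
      by (intro tendsto_mult tendsto_const tendsto_power z)
    show "\<forall>\<^sub>F (k, n) in at_top \<times>\<^sub>F sequentially. norm (of_real (coupling k) * (of_real (r n) * u) ^ (2 * k)) \<le> coupling k"
      using term_bound by (intro always_eventually) auto
  qed simp
  from tendsto_mult[OF z this]
  have lim1: "(\<lambda>n. of_real (r n) * u * (\<Sum>k. of_real (coupling k) * (of_real (r n) * u) ^ (2 * k))) \<longlonglongrightarrow> u * H" .
  have eq: "of_real (r n) * u * (\<Sum>k. of_real (coupling k) * (of_real (r n) * u) ^ (2 * k))
     = 3 / 2 * (((of_real (r n) * u)\<^sup>2 - 1) * B (of_real (r n) * u) + of_real (r n) * u)" for n
  proof -
    have "summable (\<lambda>k. norm (of_real (coupling k) * (of_real (r n) * u) ^ (2 * k)))"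
      by (rule summable_comparison_test'[OF summable_coupling, of 0]) (use term_bound in simp)
    then have "of_real (r n) * u * (\<Sum>k. of_real (coupling k) * (of_real (r n) * u) ^ (2 * k))
       = (\<Sum>k. of_real (r n) * u * (of_real (coupling k) * (of_real (r n) * u) ^ (2 * k)))"
      by (rule suminf_mult[OF summable_norm_cancel, symmetric])
    also have "\<dots> = 3 / 2 * (((of_real (r n) * u)\<^sup>2 - 1) * B (of_real (r n) * u) + of_real (r n) * u)"
      unfolding B_def by (rule sums_unique[symmetric], rule coupling_power_series) (use nz r in simp)
    finally show ?thesis .
  qed
  have sx: "0 < sin x" using x by (rule sin_gt_zero)
  have "cos x < 1" using x cos_monotone_0_pi[of 0 x] by simp
  have u1: "1 - u \<noteq> 0" using sx by (auto simp: u_def complex_eq_iff)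
  have "(1 + u) * cnj (1 - u) = of_real (2 * sin x) * \<i>"
    using sin_cos_squared_add[of x]
    by (simp add: u_def complex_eq_iff algebra_simps power2_eq_square)
  then have quot: "(1 + u) / (1 - u) = of_real (2 * sin x / (norm (1 - u))\<^sup>2) * \<i>"
    by (simp add: complex_div_cnj[of "1 + u"])
  have quot_pos: "0 < 2 * sin x / (norm (1 - u))\<^sup>2"
    using sx u1 by simp
  have "Im (Ln ((1 + u) / (1 - u))) = pi / 2"
    using quot_pos by (subst Im_Ln_eq_pi_half) (auto simp: quot)
  then have ImB: "Im (B u) = pi / 4" by (simp add: B_def)
  have "(\<lambda>n. 3 / 2 * (((of_real (r n) * u)\<^sup>2 - 1) * B (of_real (r n) * u) + of_real (r n) * u))
      \<longlonglongrightarrow> 3 / 2 * ((u\<^sup>2 - 1) * B u + u)"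
    unfolding B_def
  proof (intro tendsto_mult tendsto_const tendsto_add tendsto_diff tendsto_power z tendsto_divide tendsto_Ln u1)
    show "(1 + u) / (1 - u) \<notin> \<real>\<^sub>\<le>\<^sub>0"
      using quot_pos by (auto simp: quot complex_nonpos_Reals_iff)
  qed simp
  with lim1 have "u * H = 3 / 2 * ((u\<^sup>2 - 1) * B u + u)"
    unfolding eq by (rule LIMSEQ_unique)
  \<comment> \<open>Multiplication by \<open>cnj u = 1 / u\<close> removes the extra factor of the
    power series and turns \<open>u^2 - 1\<close> into \<open>u - cnj u\<close>, which is purely
    imaginary.\<close>
  then have "cnj u * (u * H) = cnj u * (3 / 2 * ((u\<^sup>2 - 1) * B u + u))"
    by (rule arg_cong)
  also have "\<dots> = 3 / 2 * ((cnj u * u * u - cnj u) * B u + cnj u * u)"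
    by (simp add: field_simps power2_eq_square)
  finally have "cnj u * (u * H) = 3 / 2 * ((cnj u * u * u - cnj u) * B u + cnj u * u)" .
  moreover have "cnj u * u = 1" by (simp add: u_def cis_cnj cis_mult)
  ultimately have "H = 3 / 2 * ((u - cnj u) * B u + 1)"
    by (simp add: mult.assoc[symmetric])
  also have "u - cnj u = of_real (2 * sin x) * \<i>"
    by (simp add: u_def complex_eq_iff)
  finally have ReH: "Re H = 3 / 2 - 3 * pi / 4 * sin x"
    using ImB by (simp add: algebra_simps)
  have "summable (\<lambda>k. norm (of_real (coupling k) * u ^ (2 * k)))"
    using summable_coupling coupling_nonneg by (simp add: norm_mult norm_power nu)
  then have "(\<lambda>k. of_real (coupling k) * u ^ (2 * k)) sums H"
    unfolding H_def by (rule summable_sums[OF summable_norm_cancel])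
  from sums_Re[OF this] show ?thesis
    by (simp add: ReH u_def Complex.DeMoivre)
qed

text \<open>Both sides have period \<open>pi\<close>. The endpoint 0, where the logarithm is
  singular, is covered by \<open>coupling_sums\<close>.\<close>

lemma coupling_cos_sums: "(\<lambda>k. coupling k * cos (2 * real k * x)) sums (3 / 2 - 3 * pi / 4 * \<bar>sin x\<bar>)"
proof -
  define m where "m = \<lfloor>x / pi\<rfloor>"
  define y where "y = x - of_int m * pi"
  have "of_int m \<le> x / pi" "x / pi < of_int m + 1"
    by (simp_all add: m_def)
  then have y: "0 \<le> y" "y < pi"
    by (simp_all add: y_def field_simps)
  have x_eq: "x = y + of_int m * pi" by (simp add: y_def)
  have "cos (2 * real k * x) = cos (2 * real k * y)" for k
  proof -
    have "2 * real k * x = 2 * real k * y + 2 * pi * of_int (int k * m)"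
      by (simp add: x_eq algebra_simps)
    then show ?thesis
      by (simp only: cos_add cos_int_2pin sin_int_2pin mult_1_right mult_zero_right diff_0_right)
  qed
  moreover have "\<bar>sin x\<bar> = sin y"
  proof -
    have "sin (pi * of_int m) = 0" by (simp add: mult.commute sin_zero_iff_int2)
    then have "\<bar>cos (pi * of_int m)\<bar> = 1"
      using sin_cos_squared_add[of "pi * of_int m"] by (simp add: power2_eq_1_iff abs_if)
    then have "\<bar>sin x\<bar> = \<bar>sin y\<bar>"
      unfolding x_eq sin_add mult.commute[of "of_int m"] \<open>sin (pi * of_int m) = 0\<close> by (simp add: abs_mult)
    then show ?thesis using y by (simp add: sin_ge_zero)
  qed
  moreover have "(\<lambda>k. coupling k * cos (2 * real k * y)) sums (3 / 2 - 3 * pi / 4 * sin y)"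
    using coupling_cos_sums_interior[of y] coupling_sums y by (cases "y = 0") auto
  ultimately show ?thesis by simp
qed

section \<open>The kernel, its energy and its Fourier coefficients\<close>

lemma conj_modes_unit_seqs: "(\<lambda>k. cnj (mode k \<theta>)) \<in> unit_seqs"
  by (simp add: unit_seqs_def)

text \<open>In its second variable the kernel is, up to constants, the potential of a Dirac mass at
  \<theta>, whose mode coefficients are the conjugate modes. Hence the lemmas on potentials also
  cover the convolution.\<close>

lemma W_DO_eq_potential: "W_DO (\<theta> - \<theta>') = - 2 / pi + 2 / (3 * pi) * potential (\<lambda>k. cnj (mode k \<theta>)) \<theta>'"
proof -
  have "Re (cnj (mode k \<theta>) * mode k \<theta>') = cos (2 * real k * (2 * pi * (\<theta> - \<theta>')))" for k
    using cos_minus[of "4 * pi * real k * (\<theta> - \<theta>')"]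
    by (simp add: mode_def cis_cnj cis_mult algebra_simps)
  then have term_eq: "Re (of_real (coupling k) * cnj (mode k \<theta>) * mode k \<theta>')
      = coupling k * cos (2 * real k * (2 * pi * (\<theta> - \<theta>')))" for k
    by (simp add: mult.assoc)
  have "Re (\<Sum>k. of_real (coupling k) * cnj (mode k \<theta>) * mode k \<theta>')
      = (\<Sum>k. Re (of_real (coupling k) * cnj (mode k \<theta>) * mode k \<theta>'))"
    by (rule Re_suminf[OF summable_norm_cancel[OF summable_coupling_mode[OF conj_modes_unit_seqs]]])
  also have "\<dots> = 3 / 2 - 3 * pi / 4 * \<bar>sin (2 * pi * (\<theta> - \<theta>'))\<bar>"
    unfolding term_eq by (rule sums_unique[symmetric], rule coupling_cos_sums)
  finally show ?thesis
    by (simp add: potential_def W_DO_def field_simps)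
qed

lemma interaction_W_DO:
  assumes q: "is_density q"
  shows "interaction W_DO q = - 2 / pi + 4 / (3 * pi) * mode_energy (mode_coeff q)"
proof -
  note qd = is_density_torus[OF q]
  let ?f = "potential (mode_coeff q)"
  have pot_int: "integrable torus_measure (\<lambda>\<theta>. q \<theta> * potential b \<theta>)" if "b \<in> unit_seqs" for b
    using integrable_density_mult[OF qd(3) borel_measurable_potential[OF that], of "2 * suminf coupling"]
      potential_bound[OF that] by simp
  \<comment> \<open>Symmetry of the bilinear form: pairing \<open>q\<close> with the potential of a
    point mass evaluates the potential of \<open>q\<close> at that point.\<close>
  have conv: "(\<integral>\<theta>'. q \<theta>' * potential (\<lambda>k. cnj (mode k \<theta>)) \<theta>' \<partial>torus_measure) = ?f \<theta>" for \<theta>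
  proof -
    have sm: "summable (\<lambda>k. of_real (coupling k) * mode_coeff q k * mode k \<theta>)"
      by (rule summable_norm_cancel[OF summable_coupling_mode[OF mode_coeff_unit_seqs[OF q]]])
    have "2 * coupling k * Re (cnj (mode k \<theta>) * cnj (mode_coeff q k))
        = 2 * Re (of_real (coupling k) * mode_coeff q k * mode k \<theta>)" for k
      by (simp add: algebra_simps)
    then have "(\<lambda>k. 2 * Re (of_real (coupling k) * mode_coeff q k * mode k \<theta>))
        sums (\<integral>\<theta>'. q \<theta>' * potential (\<lambda>k. cnj (mode k \<theta>)) \<theta>' \<partial>torus_measure)"
      using integral_mult_potential[OF conj_modes_unit_seqs[of \<theta>] qd(3)] by simp
    moreover have "(\<lambda>k. 2 * Re (of_real (coupling k) * mode_coeff q k * mode k \<theta>)) sums ?f \<theta>"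
      unfolding potential_def by (rule sums_mult[OF sums_Re[OF summable_sums[OF sm]]])
    ultimately show ?thesis by (rule sums_unique2)
  qed
  have "(\<integral>\<theta>'. W_DO (\<theta> - \<theta>') * q \<theta> * q \<theta>' \<partial>torus_measure) = q \<theta> * (- 2 / pi) + 2 / (3 * pi) * (q \<theta> * ?f \<theta>)" for \<theta>
  proof -
    have "(\<integral>\<theta>'. W_DO (\<theta> - \<theta>') * q \<theta> * q \<theta>' \<partial>torus_measure)
        = (\<integral>\<theta>'. q \<theta> * (- 2 / pi) * q \<theta>' + 2 / (3 * pi) * q \<theta> * (q \<theta>' * potential (\<lambda>k. cnj (mode k \<theta>)) \<theta>') \<partial>torus_measure)"
      unfolding W_DO_eq_potential by (intro Bochner_Integration.integral_cong refl) (simp add: algebra_simps)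
    also have "\<dots> = q \<theta> * (- 2 / pi) + 2 / (3 * pi) * q \<theta> * ?f \<theta>"
      using qd pot_int[OF conj_modes_unit_seqs[of \<theta>]]
      by (subst Bochner_Integration.integral_add) (auto simp: conv)
    finally show ?thesis by simp
  qed
  then have "interaction W_DO q = (\<integral>\<theta>. q \<theta> * (- 2 / pi) + 2 / (3 * pi) * (q \<theta> * ?f \<theta>) \<partial>torus_measure)"
    unfolding interaction_def set_integral_torus by simp
  also have "\<dots> = - 2 / pi + 2 / (3 * pi) * (2 * mode_energy (mode_coeff q))"
    using qd pot_int[OF mode_coeff_unit_seqs[OF q]]
    by (subst Bochner_Integration.integral_add) (auto simp: integral_mult_own_potential[OF q])
  finally show ?thesis by simp
qed

lemma fourier_coeff_W_DO:
  assumes k: "k \<ge> 1"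
  shows "fourier_coeff W_DO k = of_real (if even k then 2 / (3 * pi) * coupling (nat (k div 2)) else 0)"
proof -
  let ?e = "\<lambda>\<theta>. cis (- 2 * pi * of_int k * \<theta>)"
  \<comment> \<open>The mode coefficients of a Dirac mass at 0.\<close>
  let ?one = "\<lambda>_::nat. 1 :: complex"
  have one: "?one \<in> unit_seqs" by (simp add: unit_seqs_def)
  have int_cis: "(\<integral>\<theta>. cis (2 * pi * of_int m * \<theta>) \<partial>torus_measure) = (if m = 0 then 1 else 0)" for m
    using integral_cis_torus[of m] by simp
  have emeas [measurable]: "?e \<in> borel_measurable borel"
    by (intro borel_measurable_continuous_onI continuous_intros)
  have eint: "integrable torus_measure ?e"
    by (rule integrable_torus_bounded[OF borel_measurable_torus[OF emeas], of 1]) simp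
  have e0: "integral\<^sup>L torus_measure ?e = 0"
    using int_cis[of "- k"] k by simp
  have W: "W_DO \<theta> = - 2 / pi + 2 / (3 * pi) * potential ?one \<theta>" for \<theta>
    using W_DO_eq_potential[of 0 \<theta>] by (simp add: mode_def W_DO_def)
  have pot: "of_real (potential ?one \<theta>) * ?e \<theta> = (\<Sum>l. of_real (coupling l) * (mode l \<theta> * ?e \<theta> + cnj (mode l \<theta>) * ?e \<theta>))" for \<theta>
  proof -
    have "(\<lambda>l. of_real (coupling l) * mode l \<theta>) sums (\<Sum>l. of_real (coupling l) * mode l \<theta>)" (is "_ sums ?s")
      using summable_sums[OF summable_norm_cancel[OF summable_coupling_mode[OF one, of \<theta>]]] by simp
    from sums_mult2[OF sums_add[OF this sums_cnj[THEN iffD2, OF this]], of "?e \<theta>"]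
    have "(\<lambda>l. (of_real (coupling l) * mode l \<theta> + cnj (of_real (coupling l) * mode l \<theta>)) * ?e \<theta>) sums ((?s + cnj ?s) * ?e \<theta>)" .
    moreover have "?s + cnj ?s = of_real (potential ?one \<theta>)"
      by (simp add: potential_def complex_add_cnj)
    ultimately show ?thesis by (simp add: sums_iff algebra_simps)
  qed
  have bound: "norm (of_real (coupling l) * (mode l \<theta> * ?e \<theta> + cnj (mode l \<theta>) * ?e \<theta>)) \<le> 2 * coupling l * 1" for l \<theta>
  proof -
    have "norm (mode l \<theta> * ?e \<theta> + cnj (mode l \<theta>) * ?e \<theta>) \<le> 2"
      by (rule norm_triangle_le) (simp add: norm_mult)
    then show ?thesis
      using coupling_nonneg[of l] mult_left_mono by (fastforce simp: norm_mult)
  qed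
  have tmeas: "(\<lambda>\<theta>. of_real (coupling l) * (mode l \<theta> * ?e \<theta> + cnj (mode l \<theta>) * ?e \<theta>)) \<in> borel_measurable torus_measure" for l
    by (rule borel_measurable_torus) measurable
  note dom = integral_dominated_suminf[where M = torus_measure and h = "\<lambda>_. 1" and C = "\<lambda>l. 2 * coupling l",
      OF tmeas _ bound summable_mult[OF summable_coupling]]
  \<comment> \<open>The frequencies are \<open>2 * l - k\<close> and \<open>- 2 * l - k\<close>; the
    second never vanishes because \<open>k \<ge> 1\<close>.\<close>
  have modes: "(\<integral>\<theta>. of_real (coupling l) * (mode l \<theta> * ?e \<theta> + cnj (mode l \<theta>) * ?e \<theta>) \<partial>torus_measure)
      = (if int (2 * l) = k then of_real (coupling l) else 0)" for l
  proof -
    let ?c = "\<lambda>m \<theta>. cis (2 * pi * of_int m * \<theta>)"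
    have cint: "integrable torus_measure (?c m)" for m
      by (rule integrable_torus_bounded[where B = 1])
         (auto intro!: borel_measurable_torus borel_measurable_continuous_onI continuous_intros)
    have "mode l \<theta> * ?e \<theta> = ?c (2 * int l - k) \<theta>" "cnj (mode l \<theta>) * ?e \<theta> = ?c (- 2 * int l - k) \<theta>" for \<theta>
      unfolding mode_def cis_cnj cis_mult
      by (rule arg_cong[of _ _ cis], simp add: algebra_simps)+
    then have "(\<integral>\<theta>. of_real (coupling l) * (mode l \<theta> * ?e \<theta> + cnj (mode l \<theta>) * ?e \<theta>) \<partial>torus_measure)
        = of_real (coupling l) * (\<integral>\<theta>. ?c (2 * int l - k) \<theta> + ?c (- 2 * int l - k) \<theta> \<partial>torus_measure)"
      by (simp only: integral_mult_right_zero)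
    also have "(\<integral>\<theta>. ?c (2 * int l - k) \<theta> + ?c (- 2 * int l - k) \<theta> \<partial>torus_measure) = (if int (2 * l) = k then 1 else 0)"
      unfolding Bochner_Integration.integral_add[OF cint cint] int_cis using k by simp
    finally show ?thesis by (simp only: if_distrib[of "(*) _"] mult_1_right mult_zero_right)
  qed
  have pint: "integrable torus_measure (\<lambda>\<theta>. of_real (potential ?one \<theta>) * ?e \<theta>)"
    unfolding pot by (rule dom(1)) auto
  have sums1: "(\<lambda>l. if int (2 * l) = k then of_real (coupling l) else 0) sums (\<integral>\<theta>. of_real (potential ?one \<theta>) * ?e \<theta> \<partial>torus_measure)"
    unfolding pot modes[symmetric] by (rule dom(2)) auto
  have "(\<integral>\<theta>. of_real (potential ?one \<theta>) * ?e \<theta> \<partial>torus_measure) = of_real (if even k then coupling (nat (k div 2)) else 0)"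
  proof (cases "even k")
    case True
    then have "int (2 * l) = k \<longleftrightarrow> l = nat (k div 2)" for l
      using k by auto
    then show ?thesis
      using sums_unique2[OF sums1] sums_single[of "nat (k div 2)" "\<lambda>l. complex_of_real (coupling l)"] True by simp
  next
    case False
    then have "int (2 * l) \<noteq> k" for l by auto
    then show ?thesis
      using sums_unique2[OF sums1] sums_zero False by simp
  qed
  moreover have "fourier_coeff W_DO k = (\<integral>\<theta>. of_real (- 2 / pi) * ?e \<theta> + of_real (2 / (3 * pi)) * (of_real (potential ?one \<theta>) * ?e \<theta>) \<partial>torus_measure)"
    unfolding fourier_coeff_def set_integral_torus W
    by (intro Bochner_Integration.integral_cong refl) (simp add: algebra_simps)
  moreover have "\<dots> = of_real (2 / (3 * pi)) * (\<integral>\<theta>. of_real (potential ?one \<theta>) * ?e \<theta> \<partial>torus_measure)"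
    using eint pint e0 by (subst Bochner_Integration.integral_add) auto
  ultimately show ?thesis by simp
qed

lemma K_sharp_W_DO: "K_sharp W_DO = 3 * pi / 4"
proof -
  let ?X = "{Re (fourier_coeff W_DO k) | k. k \<ge> 1 \<and> Im (fourier_coeff W_DO k) = 0 \<and> Re (fourier_coeff W_DO k) > 0}"
  have "Sup ?X = 2 / (3 * pi)"
  proof (rule cSup_eq_maximum)
    \<comment> \<open>The maximum sits at frequency 2, which carries \<open>coupling 1\<close>; the
      coefficient at frequency 1 is 0.\<close>
    have "fourier_coeff W_DO 2 = of_real (2 / (3 * pi))"
      by (simp add: fourier_coeff_W_DO)
    then show "2 / (3 * pi) \<in> ?X"
      by (intro CollectI exI[of _ 2]) simp
  next
    fix x assume "x \<in> ?X"
    then obtain k where "k \<ge> 1" "x = Re (fourier_coeff W_DO k)" by blast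
    moreover have "coupling l \<le> 1" for l
      using mult_right_mono[of 1 "real l" "coupling l"] mult_coupling_le[of l] coupling_nonneg[of l]
      by (cases "l = 0") auto
    then have "2 / (3 * pi) * coupling l \<le> 2 / (3 * pi)" for l
      by (intro mult_left_le) auto
    ultimately show "x \<le> 2 / (3 * pi)"
      by (simp add: fourier_coeff_W_DO)
  qed
  then show ?thesis
    by (simp add: K_sharp_def)
qed

section \<open>The phase transition\<close>

text \<open>The mean \<open>- 2 / pi\<close> of the kernel adds the same constant for every density.
  The factor \<open>4 * K / (3 * pi)\<close> is the normalized coupling \<open>s\<close>.\<close>

lemma free_energy_W_DO:
  assumes "is_density q"
  shows "free_energy W_DO K q =
    (if integrable torus_measure (\<lambda>\<theta>. q \<theta> * ln (q \<theta>))
     then ereal ((\<integral>\<theta>. q \<theta> * ln (q \<theta>) \<partial>torus_measure) - 4 * K / (3 * pi) * mode_energy (mode_coeff q) + 2 * K / pi)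
     else \<infinity>)"
  by (simp add: free_energy_def entropy_def set_integrable_torus set_integral_torus interaction_W_DO[OF assms]
      algebra_simps)

lemma uniform_values:
  assumes "is_density q" "is_uniform q"
  shows "mode_energy (mode_coeff q) = 0" and "integrable torus_measure (\<lambda>\<theta>. q \<theta> * ln (q \<theta>))"
    and "(\<integral>\<theta>. q \<theta> * ln (q \<theta>) \<partial>torus_measure) = 0"
proof -
  note qd = is_density_torus[OF assms(1)]
  note [measurable] = qd(1)
  have ae: "AE \<theta> in torus_measure. q \<theta> = 1"
    using assms(2) by (simp add: is_uniform_def AE_torus q_unif_def)
  have "mode_coeff q k = (\<integral>\<theta>. mode 0 \<theta> * cnj (mode k \<theta>) \<partial>torus_measure)" for k
    unfolding mode_coeff_def by (rule integral_cong_AE) (use ae in auto)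
  then have "(\<lambda>k. coupling k * (norm (mode_coeff q k))\<^sup>2) = (\<lambda>_. 0)"
    unfolding integral_mode_orthonormal by auto
  then show "mode_energy (mode_coeff q) = 0"
    unfolding mode_energy_def by (simp only: suminf_zero)
  have ae0: "AE \<theta> in torus_measure. q \<theta> * ln (q \<theta>) = 0"
    using ae by eventually_elim simp
  have "integrable torus_measure (\<lambda>\<theta>. q \<theta> * ln (q \<theta>)) \<longleftrightarrow> integrable torus_measure (\<lambda>_. 0 :: real)"
    by (rule integrable_cong_AE) (use ae0 in auto)
  then show "integrable torus_measure (\<lambda>\<theta>. q \<theta> * ln (q \<theta>))" by simp
  have "(\<integral>\<theta>. q \<theta> * ln (q \<theta>) \<partial>torus_measure) = (\<integral>\<theta>. 0 \<partial>torus_measure)"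
    by (rule integral_cong_AE) (use ae0 in auto)
  then show "(\<integral>\<theta>. q \<theta> * ln (q \<theta>) \<partial>torus_measure) = 0" by simp
qed

lemma is_density_q_unif: "is_density q_unif" and is_uniform_q_unif: "is_uniform q_unif"
  by (simp_all add: is_density_def set_integrable_torus set_integral_torus q_unif_def is_uniform_def)

lemma free_energy_q_unif: "free_energy W_DO K q_unif = ereal (2 * K / pi)"
  using uniform_values[OF is_density_q_unif is_uniform_q_unif] by (simp add: free_energy_W_DO is_density_q_unif)

text \<open>Comparison with the uniform density; uniqueness and convergence use minimality only
  through these facts.\<close>

lemma global_minimizer_W_DO:
  assumes "global_minimizer W_DO K q"
  shows "is_density q" and "integrable torus_measure (\<lambda>\<theta>. q \<theta> * ln (q \<theta>))"
    and "(\<integral>\<theta>. q \<theta> * ln (q \<theta>) \<partial>torus_measure) \<le> 4 * K / (3 * pi) * mode_energy (mode_coeff q)"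
proof -
  show q: "is_density q" using assms by (simp add: global_minimizer_def)
  have "free_energy W_DO K q \<le> ereal (2 * K / pi)"
    using assms is_density_q_unif by (auto simp: global_minimizer_def free_energy_q_unif[symmetric])
  then show "integrable torus_measure (\<lambda>\<theta>. q \<theta> * ln (q \<theta>))"
    and "(\<integral>\<theta>. q \<theta> * ln (q \<theta>) \<partial>torus_measure) \<le> 4 * K / (3 * pi) * mode_energy (mode_coeff q)"
    unfolding free_energy_W_DO[OF q] by (auto split: if_splits)
qed

text \<open>The gap forces zero energy, which alone would leave the odd modes free. Minimality then
  makes the entropy nonpositive, and the L1 bound concludes.\<close>

lemma subcritical_unique:
  assumes K: "K \<le> 3 * pi / 4"
  shows "global_minimizer W_DO K q_unif" and "global_minimizer W_DO K q \<Longrightarrow> is_uniform q"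
proof -
  obtain c where c: "c > 0" and gap: "\<And>q. is_density q \<Longrightarrow> integrable torus_measure (\<lambda>\<theta>. q \<theta> * ln (q \<theta>)) \<Longrightarrow>
       mode_energy (mode_coeff q) + c * (mode_energy (mode_coeff q))\<^sup>2 \<le> (\<integral>\<theta>. q \<theta> * ln (q \<theta>) \<partial>torus_measure)"
    using entropy_gap by blast
  have s: "4 * K / (3 * pi) \<le> 1" using K by (simp add: field_simps)
  have sS: "4 * K / (3 * pi) * mode_energy (mode_coeff q) \<le> mode_energy (mode_coeff q)" if "is_density q" for q
    using mult_right_mono[OF s mode_energy_nonneg[OF mode_coeff_unit_seqs[OF that]]] by simp
  have "free_energy W_DO K q_unif \<le> free_energy W_DO K p" if p: "is_density p" for p
  proof (cases "integrable torus_measure (\<lambda>\<theta>. p \<theta> * ln (p \<theta>))")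
    case True
    have "0 \<le> c * (mode_energy (mode_coeff p))\<^sup>2" using c by simp
    then show ?thesis
      using gap[OF p True] sS[OF p] True by (simp add: free_energy_q_unif free_energy_W_DO[OF p])
  qed (simp add: free_energy_W_DO[OF p])
  then show "global_minimizer W_DO K q_unif"
    by (simp add: global_minimizer_def is_density_q_unif)
  assume "global_minimizer W_DO K q"
  note min = global_minimizer_W_DO[OF this]
  have "c * (mode_energy (mode_coeff q))\<^sup>2 \<le> 0"
    using gap[OF min(1,2)] min(3) sS[OF min(1)] by linarith
  then have "mode_energy (mode_coeff q) = 0"
    using c by (simp add: mult_le_0_iff)
  with min(3) have "(\<integral>\<theta>. q \<theta> * ln (q \<theta>) \<partial>torus_measure) \<le> 0"
    by simp
  then have "(l1_dist_unif q)\<^sup>2 \<le> 0"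
    using l1_dist_unif_le_entropy[OF min(1,2)] by linarith
  then show "is_uniform q"
    by (simp add: is_uniform_iff_l1[OF min(1)])
qed

text \<open>A dual minimizer exists by compactness. Its density reaches the dual minimum, a lower
  bound for all densities; since that value is negative, the uniform density, with value 0, is
  excluded.\<close>

lemma supercritical_minimizer:
  assumes K: "K > 3 * pi / 4"
  shows "\<exists>q. global_minimizer W_DO K q \<and> \<not> is_uniform q"
proof -
  define s where "s = 4 * K / (3 * pi)"
  have s: "1 < s" using K by (simp add: s_def field_simps)
  obtain a where a: "a \<in> unit_seqs" and a_min: "\<And>b. b \<in> unit_seqs \<Longrightarrow> dual_energy s a \<le> dual_energy s b"
    using dual_energy_minimizer by blast
  have neg: "dual_energy s a < 0"
    using dual_energy_negative[OF s] a_min by (metis order_le_less_trans)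
  obtain q where q: "is_density q" and ent: "integrable torus_measure (\<lambda>\<theta>. q \<theta> * ln (q \<theta>))"
    and le: "(\<integral>\<theta>. q \<theta> * ln (q \<theta>) \<partial>torus_measure) - s * mode_energy (mode_coeff q) \<le> dual_energy s a"
    using dual_energy_attained_by_density[OF a, of s] s by auto
  have "free_energy W_DO K q \<le> free_energy W_DO K p" if p: "is_density p" for p
  proof (cases "integrable torus_measure (\<lambda>\<theta>. p \<theta> * ln (p \<theta>))")
    case True
    have "dual_energy s a \<le> (\<integral>\<theta>. p \<theta> * ln (p \<theta>) \<partial>torus_measure) - s * mode_energy (mode_coeff p)"
      using a_min[OF mode_coeff_unit_seqs[OF p]] dual_energy_le[OF p True] by (rule order_trans)
    with le ent True show ?thesis
      by (simp add: free_energy_W_DO q p s_def)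
  qed (simp add: free_energy_W_DO[OF p])
  then have "global_minimizer W_DO K q"
    using q by (simp add: global_minimizer_def)
  moreover have "\<not> is_uniform q"
    using uniform_values[OF q] le neg by auto
  ultimately show ?thesis by blast
qed

text \<open>Gap and minimality give \<open>S + c * S^2 \<le> s * S\<close>, hence
  \<open>S \<le> (s - 1) / c\<close>. The entropy is at most \<open>s * S\<close>, so the L1
  distance decays at least like the square root of \<open>s - 1\<close>.\<close>

lemma minimizers_tendsto_uniform:
  assumes min: "\<And>K. K > 3 * pi / 4 \<Longrightarrow> global_minimizer W_DO K (qs K)"
  shows "((\<lambda>K. l1_dist_unif (qs K)) \<longlongrightarrow> 0) (at_right (3 * pi / 4))"
proof -
  obtain c where c: "c > 0" and gap: "\<And>q. is_density q \<Longrightarrow> integrable torus_measure (\<lambda>\<theta>. q \<theta> * ln (q \<theta>)) \<Longrightarrow>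
       mode_energy (mode_coeff q) + c * (mode_energy (mode_coeff q))\<^sup>2 \<le> (\<integral>\<theta>. q \<theta> * ln (q \<theta>) \<partial>torus_measure)"
    using entropy_gap by blast
  let ?s = "\<lambda>K. 4 * K / (3 * pi)"
  let ?u = "\<lambda>K. sqrt (4 * (?s K * ((?s K - 1) / c)))"
  have bound: "l1_dist_unif (qs K) \<le> ?u K" if K: "K > 3 * pi / 4" for K
  proof -
    define s where "s = 4 * K / (3 * pi)"
    define S where "S = mode_energy (mode_coeff (qs K))"
    note m = global_minimizer_W_DO[OF min[OF K]]
    have s: "1 < s" using K by (simp add: s_def field_simps)
    have S0: "0 \<le> S" unfolding S_def by (rule mode_energy_nonneg[OF mode_coeff_unit_seqs[OF m(1)]])
    have "S + c * S\<^sup>2 \<le> s * S"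
      using gap[OF m(1,2)] m(3) by (simp add: S_def s_def)
    then have "(c * S) * S \<le> (s - 1) * S"
      by (simp add: algebra_simps power2_eq_square)
    then have "c * S \<le> s - 1"
      using S0 s by (cases "S = 0") auto
    then have "S \<le> (s - 1) / c"
      using c by (simp add: field_simps)
    then have "s * S \<le> s * ((s - 1) / c)"
      using s by (intro mult_left_mono) auto
    then have "(l1_dist_unif (qs K))\<^sup>2 \<le> 4 * (s * ((s - 1) / c))"
      using l1_dist_unif_le_entropy[OF m(1,2)] m(3) by (simp add: S_def s_def)
    then show ?thesis
      unfolding s_def by (rule real_le_rsqrt)
  qed
  have "(?u \<longlongrightarrow> ?u (3 * pi / 4)) (at_right (3 * pi / 4))"
    using c by (intro tendsto_intros) auto
  then have lim: "(?u \<longlongrightarrow> 0) (at_right (3 * pi / 4))"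
    by simp
  have "\<forall>\<^sub>F K in at_right (3 * pi / 4). l1_dist_unif (qs K) \<le> ?u K"
    using eventually_at_right_less[of "3 * pi / 4"] by eventually_elim (rule bound)
  then show ?thesis
    by (rule tendsto_sandwich[OF always_eventually[OF allI[OF l1_dist_unif_nonneg]] _ tendsto_const lim])
qed

theorem theorem1p8:
  shows "critical_coupling W_DO (3 * pi / 4) \<and> K_sharp W_DO = 3 * pi / 4
         \<and> continuous_transition W_DO (3 * pi / 4)"
proof (intro conjI)
  show "critical_coupling W_DO (3 * pi / 4)"
    unfolding critical_coupling_def
    by (intro conjI allI impI supercritical_minimizer subcritical_unique) (auto intro: subcritical_unique(2))
  show "K_sharp W_DO = 3 * pi / 4"
    by (rule K_sharp_W_DO)
  show "continuous_transition W_DO (3 * pi / 4)"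
    unfolding continuous_transition_def
    by (intro conjI allI impI minimizers_tendsto_uniform) (auto intro: subcritical_unique(2)[OF order_refl])
qed

end
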